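(* Let $N\ge1$. For each $n\in\mathbb{N}$ let $\mu_n^{\rm b}=(\mu_{n,1}^{\rm b},\dots,\mu_{n,N}^{\rm b})$ and $\mu_n^{\rm a}=(\mu_{n,1}^{\rm a},\dots,\mu_{n,N}^{\rm a})$ be valid bid and ask marginals, and suppose that $$\mu_{n,i}^{\rm b}\preceq_{\rm cx}\mu_{m,i}^{\rm b}\preceq_{\rm cx}\mu_{m,i}^{\rm a}\preceq_{\rm cx}\mu_{n,i}^{\rm a}\qquad\text{for all } n\le m,\ i\in\{1,\dots,N\}.$$ Then the (componentwise weak) limits $\mu_\infty^{\rm b}=\lim_m\mu_m^{\rm b}$ and $\mu_\infty^{\rm a}=\lim_m\mu_m^{\rm a}$ exist and are again valid bid and ask marginals. Let $h:\mathbb{R}_+^N\to\mathbb{R}$ be upper semicontinuous, of linear growth and bounded from above, and set $$P_n(h)=\sup_{\mathbb{Q}\in\mathcal{Q}(\mu_n^{\rm b},\mu_n^{\rm a})}\mathbb{E}_{\mathbb{Q}}[h(X_1,\dots,X_N)],\qquad n\in\mathbb{N}\cup\{\infty\}.$$ Then $P_n(h)\to P_\infty(h)$ as $n\to\infty$. In particular, if $\mu_\infty^{\rm b}=\mu_\infty^{\rm a}=:\mu_\infty$, then $P_n(h)$ converges to $\sup_{\mathbb{Q}\in\mathcal{Q}(\mu_\infty)}\mathbb{E}_{\mathbb{Q}}[h(X_1,\dots,X_N)]$, where $\mathcal{Q}(\mu_\infty)$ is the set of martingale measures whose $i$-th marginal is $\mu_{\infty,i}$ for every $i$.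
   Context: $\mathbb{R}_+=[0,\infty)$; $x_0\in\mathbb{R}_+$ is a fixed constant. Linear growth of $f$ on $\mathbb{R}_+^N$: $\sup_x |f(x)|/(1+\|x\|)<\infty$. For probability measures $\mu,\nu$ on $\mathbb{R}_+$ with finite first moment, $\mu\preceq_{\rm cx}\nu$ (convex order) means $\int\psi\,d\mu\le\int\psi\,d\nu$ for all continuous convex $\psi:\mathbb{R}_+\to\mathbb{R}$ of linear growth. A pair $(\mu^{\rm b},\mu^{\rm a})$ of $N$-vectors of probability measures on $\mathbb{R}_+$ with finite first moment is called valid bid and ask marginals if all components have barycenter $x_0$ and $\mu_i^{\rm b}\preceq_{\rm cx}\mu_j^{\rm a}$ for all $1\le i\le j\le N$. Let $X_1,\dots,X_N$ be the canonical process on $\mathbb{R}_+^N$ and $X_0:=x_0$. A martingale measure is a probability measure $\mathbb{Q}$ on $\mathbb{R}_+^N$ such that $(X_i)_{0\le i\le N}$ is a $\mathbb{Q}$-martingale; $\mu_i^{\mathbb{Q}}$ is the law of $X_i$ under $\mathbb{Q}$. $\mathcal{Q}(\mu^{\rm b},\mu^{\rm a})=\{\mathbb{Q}\text{ martingale measure}:\mu_i^{\rm b}\preceq_{\rm cx}\mu_i^{\mathbb{Q}}\preceq_{\rm cx}\mu_i^{\rm a},\ i=1,\dots,N\}$. *)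

theory Defs
  imports "HOL-Probability.Probability"
begin

text \<open>Conventions. A probability measure on \<open>[0,\<infinity>)\<close> is a Borel probability measure on the
  real line that is concentrated on \<open>[0,\<infinity>)\<close>; as \<open>[0,\<infinity>)\<close> is closed, weak convergence is the same
  in both readings and \<^const>\<open>weak_conv_m\<close> applies. An \<open>N\<close>-vector is a function on \<^typ>\<open>nat\<close> of which
  only the values at \<open>1, \<dots>, N\<close> matter.\<close>

definition linear_growth_on :: "('a \<Rightarrow> real) \<Rightarrow> 'a set \<Rightarrow> ('a \<Rightarrow> real) \<Rightarrow> bool" where
  "linear_growth_on nrm S f \<longleftrightarrow> bdd_above ((\<lambda>x. \<bar>f x\<bar> / (1 + nrm x)) ` S)"

definition cx_le :: "real measure \<Rightarrow> real measure \<Rightarrow> bool" where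
  "cx_le \<mu> \<nu> \<longleftrightarrow>
     (\<forall>\<psi>. continuous_on {0..} \<psi> \<longrightarrow> convex_on {0..} \<psi> \<longrightarrow> linear_growth_on norm {0..} \<psi> \<longrightarrow>
        (LINT x:{0..}|\<mu>. \<psi> x) \<le> (LINT x:{0..}|\<nu>. \<psi> x))"

definition half_line_distribution :: "real measure \<Rightarrow> bool" where
  "half_line_distribution \<mu> \<longleftrightarrow>
     real_distribution \<mu> \<and> (AE x in \<mu>. 0 \<le> x) \<and> integrable \<mu> (\<lambda>x. x)"

definition valid_marginals ::
    "nat \<Rightarrow> real \<Rightarrow> (nat \<Rightarrow> real measure) \<Rightarrow> (nat \<Rightarrow> real measure) \<Rightarrow> bool" where
  "valid_marginals N x0 \<mu>b \<mu>a \<longleftrightarrow>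
     (\<forall>i\<in>{1..N}. half_line_distribution (\<mu>b i) \<and> (\<integral>x. x \<partial>\<mu>b i) = x0 \<and>
                 half_line_distribution (\<mu>a i) \<and> (\<integral>x. x \<partial>\<mu>a i) = x0) \<and>
     (\<forall>i\<in>{1..N}. \<forall>j\<in>{i..N}. cx_le (\<mu>b i) (\<mu>a j))"

text \<open>The orthant \<open>[0,\<infinity>)\<^sup>N\<close> consists of the extensional functions \<open>{1..N} \<rightarrow> [0,\<infinity>)\<close>, with the
  Borel sets and the topology of the \<open>N\<close>-fold product.\<close>

definition orthant_algebra :: "nat \<Rightarrow> (nat \<Rightarrow> real) measure" where
  "orthant_algebra N = (\<Pi>\<^sub>M i\<in>{1..N}. restrict_space borel {0..})"

definition orthant_topology :: "nat \<Rightarrow> (nat \<Rightarrow> real) topology" where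
  "orthant_topology N = product_topology (\<lambda>i. top_of_set {0..}) {1..N}"

abbreviation orthant :: "nat \<Rightarrow> (nat \<Rightarrow> real) set" where
  "orthant N \<equiv> {1..N} \<rightarrow>\<^sub>E {0..}"

definition upper_semicontinuous_map :: "'a topology \<Rightarrow> ('a \<Rightarrow> real) \<Rightarrow> bool" where
  "upper_semicontinuous_map T f \<longleftrightarrow> (\<forall>c. openin T {x \<in> topspace T. f x < c})"

definition canonical_process :: "real \<Rightarrow> nat \<Rightarrow> (nat \<Rightarrow> real) \<Rightarrow> real" where
  "canonical_process x0 i \<omega> = (if i = 0 then x0 else \<omega> i)"

definition natural_filtration :: "'a set \<Rightarrow> (nat \<Rightarrow> 'a \<Rightarrow> real) \<Rightarrow> nat \<Rightarrow> 'a measure" where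
  "natural_filtration \<Omega> X i = sigma \<Omega> {X j -` A \<inter> \<Omega> |j A. j \<le> i \<and> A \<in> sets borel}"

definition martingale_upto ::
    "nat \<Rightarrow> 'a measure \<Rightarrow> (nat \<Rightarrow> 'a measure) \<Rightarrow> (nat \<Rightarrow> 'a \<Rightarrow> real) \<Rightarrow> bool" where
  "martingale_upto N M F X \<longleftrightarrow>
     (\<forall>i\<le>N. subalgebra M (F i)) \<and>
     (\<forall>i\<le>N. X i \<in> borel_measurable (F i) \<and> integrable M (X i)) \<and>
     (\<forall>i j. i \<le> j \<longrightarrow> j \<le> N \<longrightarrow> (AE \<omega> in M. real_cond_exp M (F i) (X j) \<omega> = X i \<omega>))"

definition martingale_measure :: "nat \<Rightarrow> real \<Rightarrow> (nat \<Rightarrow> real) measure \<Rightarrow> bool" where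
  "martingale_measure N x0 Q \<longleftrightarrow>
     prob_space Q \<and> sets Q = sets (orthant_algebra N) \<and>
     martingale_upto N Q (natural_filtration (orthant N) (canonical_process x0))
       (canonical_process x0)"

definition law :: "(nat \<Rightarrow> real) measure \<Rightarrow> nat \<Rightarrow> real measure" where
  "law Q i = distr Q borel (\<lambda>\<omega>. \<omega> i)"

definition bid_ask_martingale_measures ::
    "nat \<Rightarrow> real \<Rightarrow> (nat \<Rightarrow> real measure) \<Rightarrow> (nat \<Rightarrow> real measure) \<Rightarrow> (nat \<Rightarrow> real) measure set" where
  "bid_ask_martingale_measures N x0 \<mu>b \<mu>a =
     {Q. martingale_measure N x0 Q \<and>
         (\<forall>i\<in>{1..N}. cx_le (\<mu>b i) (law Q i) \<and> cx_le (law Q i) (\<mu>a i))}"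

definition martingale_measures_with_marginals ::
    "nat \<Rightarrow> real \<Rightarrow> (nat \<Rightarrow> real measure) \<Rightarrow> (nat \<Rightarrow> real) measure set" where
  "martingale_measures_with_marginals N x0 \<mu> =
     {Q. martingale_measure N x0 Q \<and> (\<forall>i\<in>{1..N}. law Q i = \<mu> i)}"

text \<open>Points \<open>\<omega>\<close> of the orthant are themselves \<open>(X\<^sub>1, \<dots>, X\<^sub>N)\<close>, so the expectation of the payoff
  is the integral of \<open>h\<close>. The supremum is taken in the extended reals.\<close>

definition sup_expectation ::
    "(nat \<Rightarrow> real) measure set \<Rightarrow> ((nat \<Rightarrow> real) \<Rightarrow> real) \<Rightarrow> ereal" where
  "sup_expectation \<Q> h = (SUP Q\<in>\<Q>. ereal (\<integral>\<omega>. h \<omega> \<partial>Q))"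

end

theory Submission
  imports Defs
begin

text \<open>In each coordinate the marginals are monotone in the convex order and dominated by
  \<open>\<mu>\<^sub>0\<^sup>a\<close>. Hence they are tight and uniformly integrable and their call prices converge; as call prices
  determine a law, the marginals converge weakly, and integrals of continuous functions of linear
  growth converge as well.

  By transitivity of the convex order the sets of measures decrease and contain the limiting one, so
  \<open>P\<^sub>n(h)\<close> decreases to a value at least \<open>P\<^sub>\<infinity>(h)\<close>. Equality is a compactness statement about
  \<open>\<Q>\<^sub>n \<in> \<Q>(\<mu>\<^sub>n\<^sup>b, \<mu>\<^sub>n\<^sup>a)\<close>. Schoenberg's continuous surjection of the line onto a cube has an explicit measurable
  section, so Helly's selection theorem and Skorohod's theorem on the line yield a subsequence
  represented by random vectors that converge almost surely. Uniform integrability of the coordinates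
  carries the marginal constraints and the martingale property, tested on bounded continuous
  functions, to the limit, and Fatou's lemma handles the upper semicontinuous payoff. Nonemptiness of
  the sets is never needed, because the supremum over the empty set is \<open>-\<infinity>\<close>.\<close>

section \<open>A space-filling curve with a measurable section\<close>

text \<open>The obstacle is dimension. The martingale constraint couples the coordinates, so limits
  of the individual marginals do not suffice, while Helly's and Skorohod's theorems act on the line.
  The code turns a joint law into a law on [0, 1]. It is only measurable, but the limit of codes
  need not be a code and is never encoded again: the limit vector is the curve at the limit point,
  so continuity is asked of the curve alone. Coordinates enter as z / (1 + z). Compactness then
  costs nothing, and escape to infinity becomes the event that a coordinate of the curve equals 1,
  which the common mean x0 rules out. Call payoffs make the convex order quantitative: one bound on
  \<open>max 0 (x - K)\<close> under the dominating law controls the upper tails of all dominated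
  laws at once. The payoff needs only one-sided control, because B - h is nonnegative and lower
  semicontinuous for every upper bound B of h.\<close>

text \<open>Schoenberg's construction: on a ternary expansion with digits \<open>0\<close> and \<open>2\<close> the wave at \<open>3\<^sup>m t\<close>
  reads off the \<open>m\<close>-th digit, and \<^const>\<open>prod_encode\<close> distributes the digits over countably many
  coordinates.\<close>

definition schoenberg_wave :: "real \<Rightarrow> real" where
  "schoenberg_wave t = max 0 (min 1 (1/2 - cos (pi * t)))"

definition schoenberg_curve :: "real \<Rightarrow> nat \<Rightarrow> real" where
  "schoenberg_curve t j = (\<Sum>k. schoenberg_wave (3 ^ prod_encode (j, k) * t) / 2 ^ Suc k)"

definition binary_digit :: "nat \<Rightarrow> real \<Rightarrow> int" where
  "binary_digit k y = \<lfloor>2 ^ Suc k * y\<rfloor> mod 2"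

text \<open>Values lie in the Cantor set. Being built from floors, the code is Borel measurable,
  while its jumps at dyadic coordinates prevent continuity.\<close>

definition schoenberg_code :: "(nat \<Rightarrow> real) \<Rightarrow> real" where
  "schoenberg_code y =
     (\<Sum>m. 2 * real_of_int (binary_digit (snd (prod_decode m)) (y (fst (prod_decode m)))) / 3 ^ Suc m)"

lemma schoenberg_wave_bounds: "0 \<le> schoenberg_wave t" "schoenberg_wave t \<le> 1"
  by (auto simp: schoenberg_wave_def)

text \<open>The wave has period 2 and its clamp saturates at 60 and 120 degrees: the cosine is at
  least 1/2 on [0, pi/3] and at most -1/2 on [2 pi/3, pi]. A leading ternary digit 0 or 2 followed
  by any tail in [0, 1/3] therefore falls where the wave is constant.\<close>

lemma schoenberg_wave_at_ternary:
  assumes "b \<in> {0, 1::int}" "0 \<le> s" "s \<le> 1/3"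
  shows "schoenberg_wave (2 * of_int z + (2 * of_int b / 3 + s)) = of_int b"
proof -
  define u where "u = 2 * of_int b / 3 + s"
  have "cos (pi * (2 * of_int z + u)) = cos (2 * pi * of_int z + pi * u)"
    by (simp add: algebra_simps)
  also have "\<dots> = cos (pi * u)"
    using cos_int_2pin[of z] sin_int_2pin[of z] by (simp add: cos_add mult_ac)
  finally have *: "cos (pi * (2 * of_int z + u)) = cos (pi * u)" .
  consider "b = 0" | "b = 1" using assms by auto
  then show ?thesis
  proof cases
    case 1
    then have "pi * u \<le> pi / 3" "0 \<le> pi * u" using assms by (auto simp: u_def field_simps)
    then have "cos (pi * u) \<ge> cos (pi / 3)" by (intro cos_monotone_0_pi_le) auto
    then show ?thesis using * 1 by (simp add: schoenberg_wave_def u_def cos_60)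
  next
    case 2
    have "pi * (2/3) \<le> pi * u" "pi * u \<le> pi * 1"
      using assms 2 by (intro mult_left_mono; simp add: u_def)+
    then have "cos (pi * u) \<le> cos (2 * pi / 3)" by (intro cos_monotone_0_pi_le) auto
    then show ?thesis using * 2 by (simp add: schoenberg_wave_def u_def cos_120)
  qed
qed

lemma sums_half_powers: "(\<lambda>k. 1 / 2 ^ Suc k :: real) sums 1"
  using power_half_series by (simp add: power_one_over)

lemma summable_third_powers: "summable (\<lambda>k. 1 / 3 ^ Suc k :: real)"
proof -
  have "summable (\<lambda>k. (1/3) * (1/3) ^ k :: real)" by (intro summable_mult summable_geometric) simp
  then show ?thesis by (simp add: power_one_over)
qed

lemma suminf_third_powers: "(\<Sum>k. 1 / 3 ^ Suc k :: real) = 1 / 2"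
proof -
  have "(\<lambda>k. (1/3) * (1/3) ^ k :: real) sums ((1/3) * (1 / (1 - 1/3)))"
    by (intro sums_mult geometric_sums) simp
  then have "(\<lambda>k. 1 / 3 ^ Suc k :: real) sums (1/2)" by (simp add: power_one_over)
  then show ?thesis by (rule sums_unique[symmetric])
qed

lemma summable_ternary:
  assumes "\<And>i. b i \<in> {0, 1::int}"
  shows "summable (\<lambda>i. 2 * of_int (b i) / 3 ^ Suc (i + m) :: real)"
proof (rule summable_comparison_test'[where N = 0])
  show "summable (\<lambda>i. 2 * (1 / 3 ^ Suc i) :: real)"
    by (intro summable_mult summable_third_powers)
  fix i
  have "b i = 0 \<or> b i = 1" using assms[of i] by auto
  moreover have "(3::real) ^ Suc i \<le> 3 ^ Suc (i + m)" by (intro power_increasing) auto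
  then have "2 / 3 ^ Suc (i + m) \<le> (2 / 3 ^ Suc i :: real)"
    by (intro divide_left_mono) auto
  ultimately show "norm (2 * of_int (b i) / 3 ^ Suc (i + m) :: real) \<le> 2 * (1 / 3 ^ Suc i)"
    by auto
qed

text \<open>Scaling by \<open>3 ^ m\<close> splits the expansion into three pieces: the earlier
  digits, all even, form an even integer that the period absorbs; digit \<open>m\<close> contributes
  0 or 2/3; the remaining digits contribute at most 2/9 + 2/27 + ... = 1/3.\<close>

lemma schoenberg_wave_ternary:
  assumes b: "\<And>i. b i \<in> {0, 1::int}"
  shows "schoenberg_wave (3 ^ m * (\<Sum>i. 2 * of_int (b i) / 3 ^ Suc i)) = of_int (b m)"
proof -
  let ?a = "\<lambda>i. 2 * of_int (b i) / 3 ^ Suc i :: real"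
  have sum: "summable ?a" using summable_ternary[where m = 0 and b = b] b by simp
  define s where "s = (\<Sum>i. 2 * of_int (b (i + Suc m)) / 3 ^ Suc (i + 1) :: real)"
  have sums: "summable (\<lambda>i. 2 * of_int (b (i + Suc m)) / 3 ^ Suc (i + 1) :: real)"
    by (rule summable_ternary) (use b in auto)
  have b01: "0 \<le> b i" "b i \<le> 1" for i using b[of i] by auto
  have s0: "0 \<le> s" unfolding s_def by (rule suminf_nonneg[OF sums]) (use b01 in auto)
  have "s \<le> (\<Sum>i. (2/3) * (1 / 3 ^ Suc i))" unfolding s_def
    by (rule suminf_le[OF _ sums summable_mult[OF summable_third_powers]])
       (use b01 in \<open>auto simp: divide_simps\<close>)
  also have "\<dots> = 1/3" by (subst suminf_mult[OF summable_third_powers], subst suminf_third_powers) simp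
  finally have s1: "s \<le> 1/3" .
  define z where "z = (\<Sum>i<m. b i * 3 ^ (m - Suc i))"
  have z: "3 ^ m * (\<Sum>i<m. ?a i) = 2 * of_int z"
    unfolding z_def sum_distrib_left of_int_sum
  proof (rule sum.cong[OF refl])
    fix i assume "i \<in> {..<m}"
    then have "(3::real) ^ m = 3 ^ (m - Suc i) * 3 ^ Suc i"
      by (subst power_add[symmetric]) auto
    then show "3 ^ m * ?a i = 2 * real_of_int (b i * 3 ^ (m - Suc i))" by simp
  qed
  have "(\<Sum>i. ?a i) = (\<Sum>i. ?a (i + Suc m)) + (\<Sum>i<Suc m. ?a i)"
    by (rule suminf_split_initial_segment[OF sum])
  then have "3 ^ m * (\<Sum>i. ?a i) = 3 ^ m * (\<Sum>i. ?a (i + Suc m)) + 3 ^ m * (\<Sum>i<m. ?a i) + 3 ^ m * ?a m"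
    by (simp add: algebra_simps)
  also have "3 ^ m * (\<Sum>i. ?a (i + Suc m)) = s" unfolding s_def
    by (subst suminf_mult[symmetric])
       (use summable_ignore_initial_segment[OF sum, of "Suc m"] in
         \<open>auto intro!: suminf_cong simp: power_add field_simps\<close>)
  finally have "3 ^ m * (\<Sum>i. ?a i) = 2 * of_int z + (2 * of_int (b m) / 3 + s)"
    using z by simp
  then show ?thesis using schoenberg_wave_at_ternary[OF b s0 s1] by metis
qed

lemma binary_digit_range: "binary_digit k y \<in> {0, 1}"
  unfolding binary_digit_def by auto

lemma binary_expansion:
  assumes "0 \<le> y" "y < 1"
  shows "(\<lambda>k. of_int (binary_digit k y) / 2 ^ Suc k) sums y"
proof -
  \<comment> \<open>The partial sums truncate \<open>y\<close> to \<open>n\<close> binary places.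
    The induction starts from the integer part of \<open>y\<close> being 0, which uses
    \<open>y < 1\<close>.\<close>
  have part: "(\<Sum>k<n. of_int (binary_digit k y) / 2 ^ Suc k) = of_int \<lfloor>2 ^ n * y\<rfloor> / (2 ^ n :: real)" for n
  proof (induction n)
    case 0
    then show ?case using assms by (simp add: floor_eq_iff)
  next
    case (Suc n)
    have "\<lfloor>2 ^ n * y\<rfloor> = \<lfloor>2 ^ Suc n * y\<rfloor> div 2"
      using floor_divide_real_eq_div[of 2 "2 ^ Suc n * y"] by simp
    then have "\<lfloor>2 ^ Suc n * y\<rfloor> = 2 * \<lfloor>2 ^ n * y\<rfloor> + binary_digit n y"
      unfolding binary_digit_def by presburger
    then have "real_of_int \<lfloor>2 ^ Suc n * y\<rfloor> = 2 * real_of_int \<lfloor>2 ^ n * y\<rfloor> + real_of_int (binary_digit n y)"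
      by linarith
    with Suc show ?case by (simp add: field_simps)
  qed
  have "(\<lambda>n. of_int \<lfloor>2 ^ n * y\<rfloor> / (2 ^ n :: real)) \<longlonglongrightarrow> y"
  proof (rule LIMSEQ_I)
    fix r :: real assume "0 < r"
    then obtain N where N: "(1/2) ^ N < r" using real_arch_pow_inv[of r "1/2"] by auto
    show "\<exists>no. \<forall>n\<ge>no. norm (of_int \<lfloor>2 ^ n * y\<rfloor> / (2 ^ n :: real) - y) < r"
    proof (intro exI allI impI)
      fix n assume "n \<ge> N"
      have "(1/2::real) ^ n \<le> (1/2) ^ N" using \<open>n \<ge> N\<close> by (intro power_decreasing) auto
      have "\<bar>of_int \<lfloor>2 ^ n * y\<rfloor> - 2 ^ n * y\<bar> \<le> 1" by linarith
      then have "\<bar>of_int \<lfloor>2 ^ n * y\<rfloor> - 2 ^ n * y\<bar> / 2 ^ n \<le> 1 / 2 ^ n"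
        by (intro divide_right_mono) auto
      also have "\<bar>of_int \<lfloor>2 ^ n * y\<rfloor> - 2 ^ n * y\<bar> / 2 ^ n = \<bar>of_int \<lfloor>2 ^ n * y\<rfloor> / (2 ^ n :: real) - y\<bar>"
        by (simp add: field_simps abs_divide flip: abs_divide)
      finally show "norm (of_int \<lfloor>2 ^ n * y\<rfloor> / (2 ^ n :: real) - y) < r"
        using N \<open>(1/2::real) ^ n \<le> (1/2) ^ N\<close> by (simp add: power_one_over)
    qed
  qed
  then show ?thesis unfolding sums_def part .
qed

lemma schoenberg_curve_code:
  assumes "0 \<le> y j" "y j < 1"
  shows "schoenberg_curve (schoenberg_code y) j = y j"
proof -
  have "schoenberg_wave (3 ^ prod_encode (j, k) * schoenberg_code y) = of_int (binary_digit k (y j))" for k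
    using schoenberg_wave_ternary[of "\<lambda>m. binary_digit (snd (prod_decode m)) (y (fst (prod_decode m)))"
        "prod_encode (j, k)"] binary_digit_range
    unfolding schoenberg_code_def by simp
  then show ?thesis
    unfolding schoenberg_curve_def using sums_unique[OF binary_expansion[OF assms]] by simp
qed

lemma summable_schoenberg: "summable (\<lambda>k. schoenberg_wave (u k) / 2 ^ Suc k)"
  by (rule summable_comparison_test'[where N = 0, OF sums_summable[OF sums_half_powers]])
     (simp add: schoenberg_wave_bounds divide_right_mono)

lemma schoenberg_curve_bounds: "0 \<le> schoenberg_curve t j" "schoenberg_curve t j \<le> 1"
proof -
  show "0 \<le> schoenberg_curve t j" unfolding schoenberg_curve_def
    by (intro suminf_nonneg summable_schoenberg) (simp add: schoenberg_wave_bounds)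
  have "schoenberg_curve t j \<le> (\<Sum>k. 1 / 2 ^ Suc k)" unfolding schoenberg_curve_def
    by (intro suminf_le summable_schoenberg sums_summable[OF sums_half_powers])
       (simp add: schoenberg_wave_bounds divide_right_mono)
  then show "schoenberg_curve t j \<le> 1" using sums_unique[OF sums_half_powers] by simp
qed

lemma continuous_on_schoenberg_curve: "continuous_on UNIV (\<lambda>t. schoenberg_curve t j)"
  unfolding schoenberg_curve_def
proof (rule uniform_limit_theorem)
  show "uniform_limit UNIV (\<lambda>n t. \<Sum>k<n. schoenberg_wave (3 ^ prod_encode (j, k) * t) / 2 ^ Suc k)
      (\<lambda>t. \<Sum>k. schoenberg_wave (3 ^ prod_encode (j, k) * t) / 2 ^ Suc k) sequentially"
    by (rule Weierstrass_m_test[OF _ sums_summable[OF sums_half_powers]])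
       (simp add: schoenberg_wave_bounds divide_right_mono)
qed (auto simp: schoenberg_wave_def intro!: always_eventually continuous_intros)

text \<open>Makes the laws of the codes tight, whatever the laws on the orthant are.\<close>

lemma schoenberg_code_bounds: "0 \<le> schoenberg_code y" "schoenberg_code y \<le> 1"
proof -
  let ?b = "\<lambda>m. binary_digit (snd (prod_decode m)) (y (fst (prod_decode m)))"
  have sum: "summable (\<lambda>m. 2 * of_int (?b m) / 3 ^ Suc m :: real)"
    using summable_ternary[of ?b 0] binary_digit_range by simp
  have b01: "0 \<le> ?b m" "?b m \<le> 1" for m using binary_digit_range[of "snd (prod_decode m)" "y (fst (prod_decode m))"] by auto
  show "0 \<le> schoenberg_code y" unfolding schoenberg_code_def
    by (rule suminf_nonneg[OF sum]) (use b01 in auto)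
  have "schoenberg_code y \<le> (\<Sum>m. 2 * (1 / 3 ^ Suc m))" unfolding schoenberg_code_def
    by (rule suminf_le[OF _ sum summable_mult[OF summable_third_powers]])
       (use b01 in \<open>auto simp: divide_simps\<close>)
  then show "schoenberg_code y \<le> 1"
    by (subst (asm) suminf_mult[OF summable_third_powers], subst (asm) suminf_third_powers) simp
qed

lemma measurable_schoenberg_code:
  assumes "\<And>j. (\<lambda>x. f x j) \<in> borel_measurable M"
  shows "(\<lambda>x. schoenberg_code (f x)) \<in> borel_measurable M"
proof -
  note [measurable] = assms
  show ?thesis unfolding schoenberg_code_def binary_digit_def by measurable
qed

section \<open>Convergence of integrals\<close>

text \<open>Pratt's form of dominated convergence: the majorants may vary with \<open>n\<close> as
  long as their integrals converge. The random variables below have no common integrable majorant,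
  only convergent means.\<close>

lemma generalized_dominated_convergence:
  fixes f g :: "nat \<Rightarrow> 'a \<Rightarrow> real"
  assumes [measurable]: "\<And>n. f n \<in> borel_measurable M" "f' \<in> borel_measurable M"
    and g: "\<And>n. integrable M (g n)" "integrable M g'"
    and lim_f: "AE x in M. (\<lambda>n. f n x) \<longlonglongrightarrow> f' x"
    and lim_g: "AE x in M. (\<lambda>n. g n x) \<longlonglongrightarrow> g' x"
    and bound: "\<And>n. AE x in M. \<bar>f n x\<bar> \<le> g n x"
    and lim_int: "(\<lambda>n. \<integral>x. g n x \<partial>M) \<longlonglongrightarrow> (\<integral>x. g' x \<partial>M)"
  shows "(\<lambda>n. \<integral>x. f n x \<partial>M) \<longlonglongrightarrow> (\<integral>x. f' x \<partial>M)"
proof -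
  note [measurable] = borel_measurable_integrable[OF g(1)] borel_measurable_integrable[OF g(2)]
  have bound_all: "AE x in M. \<forall>n. \<bar>f n x\<bar> \<le> g n x" using bound by (simp add: AE_all_countable)
  have g'_nonneg: "AE x in M. 0 \<le> g' x"
    using bound_all lim_g
  proof eventually_elim
    case (elim x)
    then show ?case by (intro LIMSEQ_le_const[OF elim(2)]) (meson abs_ge_zero order_trans)
  qed
  have f'_bound: "AE x in M. \<bar>f' x\<bar> \<le> g' x"
    using bound_all lim_g lim_f
  proof eventually_elim
    case (elim x)
    then show ?case by (intro LIMSEQ_le[OF tendsto_rabs[OF elim(3)] elim(2)]) auto
  qed
  txt \<open>Truncating at \<open>g'\<close> gives an ordinary dominated sequence; the error is at most
    \<open>max 0 (g n - g') = (g n - g') + max 0 (g' - g n)\<close>, and \<open>max 0 (g' - g n)\<close> is dominated by \<open>g'\<close>.\<close>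
  define \<phi> where "\<phi> n x = max (- g' x) (min (g' x) (f n x))" for n x
  have [measurable]: "\<phi> n \<in> borel_measurable M" for n unfolding \<phi>_def by measurable
  have \<phi>: "(\<lambda>n. \<integral>x. \<phi> n x \<partial>M) \<longlonglongrightarrow> (\<integral>x. f' x \<partial>M)"
  proof (rule integral_dominated_convergence[where w = g'])
    show "AE x in M. (\<lambda>n. \<phi> n x) \<longlonglongrightarrow> f' x"
      using lim_f f'_bound
    proof eventually_elim
      case (elim x)
      have "(\<lambda>n. \<phi> n x) \<longlonglongrightarrow> max (- g' x) (min (g' x) (f' x))"
        unfolding \<phi>_def by (intro tendsto_intros elim)
      also have "max (- g' x) (min (g' x) (f' x)) = f' x" using elim by auto
      finally show ?case .
    qed
    show "AE x in M. norm (\<phi> n x) \<le> g' x" for n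
      using g'_nonneg by eventually_elim (auto simp: \<phi>_def)
  qed (use g in auto)
  have pos: "(\<lambda>n. \<integral>x. max 0 (g' x - g n x) \<partial>M) \<longlonglongrightarrow> (\<integral>x. 0 \<partial>M)"
  proof (rule integral_dominated_convergence[where w = g'])
    show "AE x in M. (\<lambda>n. max 0 (g' x - g n x)) \<longlonglongrightarrow> 0"
      using lim_g
    proof eventually_elim
      case (elim x)
      have "(\<lambda>n. max 0 (g' x - g n x)) \<longlonglongrightarrow> max 0 (g' x - g' x)" by (intro tendsto_intros elim)
      then show ?case by simp
    qed
    show "AE x in M. norm (max 0 (g' x - g n x)) \<le> g' x" for n
      using g'_nonneg bound_all by eventually_elim (force simp: max_def dest: spec[of _ n])
  qed (use g in auto)
  \<comment> \<open>The integral of the pointwise error bound. The difference of the first two terms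
    tends to 0 by \<open>lim_int\<close>, the last term by \<open>pos\<close>.\<close>
  define r where "r n = (\<integral>x. g n x \<partial>M) - (\<integral>x. g' x \<partial>M) + (\<integral>x. max 0 (g' x - g n x) \<partial>M)" for n
  have "r \<longlonglongrightarrow> (\<integral>x. g' x \<partial>M) - (\<integral>x. g' x \<partial>M) + (\<integral>x. 0 \<partial>M)"
    unfolding r_def by (intro tendsto_intros lim_int pos)
  then have r0: "r \<longlonglongrightarrow> 0" by simp
  have int_f: "integrable M (f n)" for n
    by (rule Bochner_Integration.integrable_bound[OF g(1)[of n]])
       (use bound[of n] in \<open>auto elim: eventually_mono\<close>)
  have int_\<phi>: "integrable M (\<phi> n)" for n
    by (rule Bochner_Integration.integrable_bound[OF g(2)])
       (use g'_nonneg in \<open>auto simp: \<phi>_def elim: eventually_mono\<close>)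
  have "\<bar>(\<integral>x. f n x \<partial>M) - (\<integral>x. \<phi> n x \<partial>M)\<bar> \<le> r n" for n
  proof -
    have int: "integrable M (\<lambda>x. g n x - g' x + max 0 (g' x - g n x))" using g by auto
    have "\<bar>(\<integral>x. f n x \<partial>M) - (\<integral>x. \<phi> n x \<partial>M)\<bar> = \<bar>\<integral>x. f n x - \<phi> n x \<partial>M\<bar>"
      using int_f int_\<phi> by simp
    also have "\<dots> \<le> (\<integral>x. \<bar>f n x - \<phi> n x\<bar> \<partial>M)" by (rule integral_abs_bound)
    also have "\<dots> \<le> (\<integral>x. g n x - g' x + max 0 (g' x - g n x) \<partial>M)"
    proof (rule integral_mono_AE[OF _ int])
      show "AE x in M. \<bar>f n x - \<phi> n x\<bar> \<le> g n x - g' x + max 0 (g' x - g n x)"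
        using bound[of n] g'_nonneg by eventually_elim (auto simp: \<phi>_def max_def min_def)
    qed (use int_f int_\<phi> in auto)
    also have "\<dots> = r n" unfolding r_def using g by simp
    finally show ?thesis .
  qed
  then have "(\<lambda>n. (\<integral>x. f n x \<partial>M) - (\<integral>x. \<phi> n x \<partial>M)) \<longlonglongrightarrow> 0"
    by (intro Lim_null_comparison[OF _ r0]) auto
  from tendsto_add[OF this \<phi>] show ?thesis by simp
qed

lemma integral_Fatou:
  fixes f :: "nat \<Rightarrow> 'a \<Rightarrow> real"
  assumes int: "\<And>n. integrable M (f n)" and [measurable]: "f' \<in> borel_measurable M"
    and nonneg: "\<And>n. AE x in M. 0 \<le> f n x"
    and lim: "AE x in M. (\<lambda>n. f n x) \<longlonglongrightarrow> f' x"
    and bound: "\<And>n. (\<integral>x. f n x \<partial>M) \<le> C"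
  shows "integrable M f'" "(\<integral>x. f' x \<partial>M) \<le> C"
proof -
  note [measurable] = borel_measurable_integrable[OF int]
  have nonneg_all: "AE x in M. \<forall>n. 0 \<le> f n x" using nonneg by (simp add: AE_all_countable)
  have f'_nonneg: "AE x in M. 0 \<le> f' x"
    using nonneg_all lim by eventually_elim (auto intro: LIMSEQ_le_const)
  \<comment> \<open>\<open>ennreal\<close> sends negative numbers to 0, so a bound by
    \<open>ennreal C\<close> returns to the reals only for nonnegative \<open>C\<close>.\<close>
  have C: "0 \<le> C" using bound[of 0] integral_nonneg_AE[OF nonneg[of 0]] by linarith
  have "(\<integral>\<^sup>+x. ennreal (f' x) \<partial>M) = (\<integral>\<^sup>+x. liminf (\<lambda>n. ennreal (f n x)) \<partial>M)"
  proof (rule nn_integral_cong_AE)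
    show "AE x in M. ennreal (f' x) = liminf (\<lambda>n. ennreal (f n x))"
      using lim by eventually_elim (rule lim_imp_Liminf[symmetric], auto)
  qed
  also have "\<dots> \<le> liminf (\<lambda>n. \<integral>\<^sup>+x. ennreal (f n x) \<partial>M)" by (rule nn_integral_liminf) auto
  also have "\<dots> \<le> liminf (\<lambda>n. ennreal C)"
    by (intro Liminf_mono always_eventually allI)
       (simp add: nn_integral_eq_integral[OF int nonneg] ennreal_leI bound)
  finally have le: "(\<integral>\<^sup>+x. ennreal (f' x) \<partial>M) \<le> ennreal C" by (simp add: Liminf_const)
  show int': "integrable M f'"
    by (rule integrableI_nonneg) (use f'_nonneg le in \<open>auto simp: le_less_trans\<close>)
  show "(\<integral>x. f' x \<partial>M) \<le> C"
    using le C by (simp add: nn_integral_eq_integral[OF int' f'_nonneg])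
qed

text \<open>Vitali's theorem with uniform integrability expressed by call prices, the form that the
  convex order supplies; nonnegativity leaves only the upper tail to control. Each variable is split
  at \<open>K\<close> into a bounded part, handled by dominated convergence, and a call payoff,
  small uniformly in \<open>n\<close> and, by Fatou, also in the limit.\<close>

lemma (in prob_space) uniformly_integrable_limit:
  fixes Z :: "nat \<Rightarrow> 'a \<Rightarrow> real"
  assumes int: "\<And>n. integrable M (Z n)" and [measurable]: "Z' \<in> borel_measurable M"
    and nonneg: "\<And>n. AE x in M. 0 \<le> Z n x"
    and lim: "AE x in M. (\<lambda>n. Z n x) \<longlonglongrightarrow> Z' x"
    and UI: "\<And>e. 0 < e \<Longrightarrow> \<exists>K. \<forall>n. (\<integral>x. max 0 (Z n x - K) \<partial>M) \<le> e"
  shows "integrable M Z'" "(\<lambda>n. \<integral>x. Z n x \<partial>M) \<longlonglongrightarrow> (\<integral>x. Z' x \<partial>M)"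
proof -
  note [measurable] = borel_measurable_integrable[OF int]
  have split: "f x = min (f x) K + max 0 (f x - K)" for f :: "'a \<Rightarrow> real" and x K
    by (simp add: max_def min_def)
  have nonneg_all: "AE x in M. \<forall>n. 0 \<le> Z n x" using nonneg by (simp add: AE_all_countable)
  have nonneg': "AE x in M. 0 \<le> Z' x"
    using nonneg_all lim by eventually_elim (auto intro: LIMSEQ_le_const)
  have int_min: "integrable M (\<lambda>x. min (f x) K)" if "integrable M f" for f :: "'a \<Rightarrow> real" and K
    using that by auto
  have int_max: "integrable M (\<lambda>x. max 0 (f x - K))" if "integrable M f" for f :: "'a \<Rightarrow> real" and K
    using that by auto
  obtain K where K: "\<And>n. (\<integral>x. max 0 (Z n x - K) \<partial>M) \<le> 1" using UI[of 1] by auto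
  have "(\<integral>x. Z n x \<partial>M) \<le> K + 1" for n
  proof -
    have "(\<integral>x. Z n x \<partial>M) = (\<integral>x. min (Z n x) K \<partial>M) + (\<integral>x. max 0 (Z n x - K) \<partial>M)"
      by (subst Bochner_Integration.integral_add[symmetric])
         (use int int_min int_max split in auto)
    also have "(\<integral>x. min (Z n x) K \<partial>M) \<le> (\<integral>x. K \<partial>M)"
      by (intro integral_mono int_min int) auto
    finally show ?thesis using K[of n] by (simp add: prob_space)
  qed
  from integral_Fatou(1)[OF int _ nonneg lim this] show int': "integrable M Z'" by simp
  show "(\<lambda>n. \<integral>x. Z n x \<partial>M) \<longlonglongrightarrow> (\<integral>x. Z' x \<partial>M)"
  proof (rule LIMSEQ_I)
    fix e :: real assume "0 < e"
    then obtain K where K: "\<And>n. (\<integral>x. max 0 (Z n x - K) \<partial>M) \<le> e / 3" using UI[of "e/3"] by auto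
    have K': "(\<integral>x. max 0 (Z' x - K) \<partial>M) \<le> e / 3"
    proof (rule integral_Fatou(2)[OF int_max[OF int] _ _ _ K])
      show "AE x in M. (\<lambda>n. max 0 (Z n x - K)) \<longlonglongrightarrow> max 0 (Z' x - K)"
        using lim by eventually_elim (intro tendsto_intros)
    qed auto
    \<comment> \<open>The threshold may be negative; since the variables are nonnegative, the
      minimum is bounded by \<open>\<bar>K\<bar>\<close> in either case.\<close>
    have "(\<lambda>n. \<integral>x. min (Z n x) K \<partial>M) \<longlonglongrightarrow> (\<integral>x. min (Z' x) K \<partial>M)"
    proof (rule integral_dominated_convergence[where w = "\<lambda>x. \<bar>K\<bar>"])
      show "AE x in M. (\<lambda>n. min (Z n x) K) \<longlonglongrightarrow> min (Z' x) K"
        using lim by eventually_elim (intro tendsto_intros)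
      show "AE x in M. norm (min (Z n x) K) \<le> \<bar>K\<bar>" for n
        using nonneg[of n] by eventually_elim auto
    qed auto
    then obtain n0 where n0: "\<And>n. n \<ge> n0 \<Longrightarrow> \<bar>(\<integral>x. min (Z n x) K \<partial>M) - (\<integral>x. min (Z' x) K \<partial>M)\<bar> < e / 3"
      using \<open>0 < e\<close> unfolding LIMSEQ_iff by (metis real_norm_def zero_less_divide_iff zero_less_numeral)
    have decomp: "(\<integral>x. f x \<partial>M) = (\<integral>x. min (f x) K \<partial>M) + (\<integral>x. max 0 (f x - K) \<partial>M)"
      if "integrable M f" for f
      by (subst Bochner_Integration.integral_add[symmetric])
         (use that int_min int_max split in auto)
    have pos: "0 \<le> (\<integral>x. max 0 (f x - K) \<partial>M)" for f :: "'a \<Rightarrow> real" by (rule Bochner_Integration.integral_nonneg) auto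
    show "\<exists>n0. \<forall>n\<ge>n0. norm ((\<integral>x. Z n x \<partial>M) - (\<integral>x. Z' x \<partial>M)) < e"
    proof (intro exI allI impI)
      fix n assume "n \<ge> n0"
      then show "norm ((\<integral>x. Z n x \<partial>M) - (\<integral>x. Z' x \<partial>M)) < e"
        using n0[of n] K[of n] K' pos[of "Z n"] pos[of Z'] \<open>0 < e\<close>
        unfolding decomp[OF int[of n]] decomp[OF int'] real_norm_def by linarith
    qed
  qed
qed

section \<open>The convex order on the half-line\<close>

text \<open>For laws on the half-line with finite mean this is weak convergence together with
  convergence of means, that is, convergence in the first Wasserstein distance. The test functions
  include those of the convex order, which is therefore closed under it.\<close>

definition cx_tendsto :: "(nat \<Rightarrow> real measure) \<Rightarrow> real measure \<Rightarrow> bool" where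
  "cx_tendsto \<mu> \<mu>' \<longleftrightarrow>
     (\<forall>\<psi>. continuous_on {0..} \<psi> \<longrightarrow> linear_growth_on norm {0..} \<psi> \<longrightarrow>
        (\<lambda>n. LINT x:{0..}|\<mu> n. \<psi> x) \<longlonglongrightarrow> (LINT x:{0..}|\<mu>'. \<psi> x))"

lemma cx_le_refl: "cx_le \<mu> \<mu>"
  by (simp add: cx_le_def)

lemma cx_le_trans: "cx_le \<mu> \<nu> \<Longrightarrow> cx_le \<nu> \<kappa> \<Longrightarrow> cx_le \<mu> \<kappa>"
  unfolding cx_le_def by (meson order_trans)

lemma cx_tendsto_const: "cx_tendsto (\<lambda>n. \<mu>) \<mu>"
  by (simp add: cx_tendsto_def)

lemma cx_tendsto_subseq:
  assumes "cx_tendsto \<mu> \<mu>'" "strict_mono r"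
  shows "cx_tendsto (\<lambda>n. \<mu> (r n)) \<mu>'"
  unfolding cx_tendsto_def
proof (intro allI impI)
  fix \<psi> :: "real \<Rightarrow> real"
  assume "continuous_on {0..} \<psi>" "linear_growth_on norm {0..} \<psi>"
  then have "(\<lambda>n. LINT x:{0..}|\<mu> n. \<psi> x) \<longlonglongrightarrow> (LINT x:{0..}|\<mu>'. \<psi> x)"
    using assms(1) unfolding cx_tendsto_def by simp
  from LIMSEQ_subseq_LIMSEQ[OF this assms(2)]
  show "(\<lambda>n. LINT x:{0..}|\<mu> (r n). \<psi> x) \<longlonglongrightarrow> (LINT x:{0..}|\<mu>'. \<psi> x)"
    by (simp add: o_def)
qed

text \<open>The order is asked for only from an index \<open>k\<close> on, so that a fixed member of
  a monotone sequence can be compared with the limit: a constant sequence on one side and the tail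
  of the monotone one on the other.\<close>

lemma cx_tendsto_le:
  assumes "cx_tendsto \<mu> \<mu>'" "cx_tendsto \<nu> \<nu>'" "\<And>n. k \<le> n \<Longrightarrow> cx_le (\<mu> n) (\<nu> n)"
  shows "cx_le \<mu>' \<nu>'"
  unfolding cx_le_def
proof (intro allI impI)
  fix \<psi> :: "real \<Rightarrow> real"
  assume \<psi>: "continuous_on {0..} \<psi>" "convex_on {0..} \<psi>" "linear_growth_on norm {0..} \<psi>"
  show "(LINT x:{0..}|\<mu>'. \<psi> x) \<le> (LINT x:{0..}|\<nu>'. \<psi> x)"
  proof (rule LIMSEQ_le)
    show "(\<lambda>n. LINT x:{0..}|\<mu> n. \<psi> x) \<longlonglongrightarrow> (LINT x:{0..}|\<mu>'. \<psi> x)"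
      "(\<lambda>n. LINT x:{0..}|\<nu> n. \<psi> x) \<longlonglongrightarrow> (LINT x:{0..}|\<nu>'. \<psi> x)"
      using assms(1,2) \<psi> unfolding cx_tendsto_def by simp_all
    show "\<exists>k. \<forall>n\<ge>k. (LINT x:{0..}|\<mu> n. \<psi> x) \<le> (LINT x:{0..}|\<nu> n. \<psi> x)"
      using assms(3) \<psi> unfolding cx_le_def by (intro exI[of _ k]) simp
  qed
qed

lemma half_line_distributionD:
  assumes "half_line_distribution \<mu>"
  shows "real_distribution \<mu>" "prob_space \<mu>" "sets \<mu> = sets borel" "space \<mu> = UNIV"
    "AE x in \<mu>. 0 \<le> x" "integrable \<mu> (\<lambda>x. x)"
proof -
  show "real_distribution \<mu>" using assms by (simp add: half_line_distribution_def)
  then interpret real_distribution \<mu> .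
  show "prob_space \<mu>" "sets \<mu> = sets borel" "space \<mu> = UNIV"
    by (simp_all add: prob_space_axioms)
  show "AE x in \<mu>. 0 \<le> x" "integrable \<mu> (\<lambda>x. x)"
    using assms by (simp_all add: half_line_distribution_def)
qed

lemma linear_growth_half_lineE:
  assumes "linear_growth_on norm {0..} (\<psi> :: real \<Rightarrow> real)"
  obtains C where "0 \<le> C" "\<And>x. 0 \<le> x \<Longrightarrow> \<bar>\<psi> x\<bar> \<le> C * (1 + x)"
proof -
  obtain C where C: "\<And>x. x \<in> {0..} \<Longrightarrow> \<bar>\<psi> x\<bar> / (1 + norm x) \<le> C"
    using assms unfolding linear_growth_on_def bdd_above_def by auto
  have "0 \<le> C" using C[of 0] by (simp add: order_trans[OF abs_ge_zero])
  then show thesis using C by (intro that[of C]) (auto simp: divide_simps)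
qed

text \<open>Precomposition with \<open>max 0\<close> extends a test function continuously to the
  whole line without changing it where the law lives. Almost sure limits can then be inserted
  without caring about null sets of negative values.\<close>

lemma set_lebesgue_integral_half_line:
  assumes \<mu>: "half_line_distribution \<mu>" and \<psi>: "continuous_on {0..} \<psi>"
  shows "(LINT x:{0..}|\<mu>. \<psi> x) = (\<integral>x. \<psi> (max 0 x) \<partial>\<mu>)"
  unfolding set_lebesgue_integral_def
proof (rule integral_cong_AE)
  have cont: "continuous_on UNIV (\<lambda>x. \<psi> (max 0 x))"
    by (intro continuous_on_compose2[OF \<psi>] continuous_intros) auto
  then show "(\<lambda>x. \<psi> (max 0 x)) \<in> borel_measurable \<mu>"
    using half_line_distributionD(3)[OF \<mu>] borel_measurable_continuous_onI measurable_cong_sets by blast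
  show "(\<lambda>x. indicator {0..} x *\<^sub>R \<psi> x) \<in> borel_measurable \<mu>"
    using borel_measurable_continuous_on_indicator[OF _ \<psi>]
    by (subst measurable_cong_sets[OF half_line_distributionD(3)[OF \<mu>] refl]) auto
  show "AE x in \<mu>. indicator {0..} x *\<^sub>R \<psi> x = \<psi> (max 0 x)"
    using half_line_distributionD(5)[OF \<mu>] by eventually_elim auto
qed

section \<open>Call payoffs as test functions of the convex order\<close>

lemma call_payoff:
  fixes K :: real
  shows "continuous_on {0..} (\<lambda>x. max 0 (x - K))" "convex_on {0..} (\<lambda>x. max 0 (x - K))"
    "linear_growth_on norm {0..} (\<lambda>x. max 0 (x - K))"
proof -
  show "continuous_on {0..} (\<lambda>x. max 0 (x - K))" by (intro continuous_intros)
  show "convex_on {0..} (\<lambda>x. max 0 (x - K))"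
  proof (rule convex_onI)
    fix t x y :: real assume t: "0 < t" "t < 1"
    have "(1 - t) * (x - K) \<le> (1 - t) * max 0 (x - K)" "t * (y - K) \<le> t * max 0 (y - K)"
      using t by (intro mult_left_mono; simp)+
    moreover have "0 \<le> (1 - t) * max 0 (x - K)" "0 \<le> t * max 0 (y - K)" using t by simp_all
    moreover have "(1 - t) *\<^sub>R x + t *\<^sub>R y - K = (1 - t) * (x - K) + t * (y - K)"
      by (simp add: algebra_simps)
    ultimately show "max 0 ((1 - t) *\<^sub>R x + t *\<^sub>R y - K) \<le> (1 - t) * max 0 (x - K) + t * max 0 (y - K)"
      by linarith
  qed simp
  show "linear_growth_on norm {0..} (\<lambda>x. max 0 (x - K))"
    unfolding linear_growth_on_def
  proof (rule bdd_aboveI2)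
    fix x :: real assume x: "x \<in> {0..}"
    have "0 \<le> \<bar>K\<bar> * x" using x by simp
    moreover have "(1 + \<bar>K\<bar>) * (1 + x) = 1 + x + \<bar>K\<bar> + \<bar>K\<bar> * x" by (simp add: algebra_simps)
    moreover have "0 \<le> x" "0 \<le> \<bar>K\<bar>" "- K \<le> \<bar>K\<bar>" using x by auto
    ultimately have "max 0 (x - K) \<le> (1 + \<bar>K\<bar>) * (1 + x)" by (intro max.boundedI; linarith)
    then show "\<bar>max 0 (x - K)\<bar> / (1 + norm x) \<le> 1 + \<bar>K\<bar>"
      using x by (simp add: pos_divide_le_eq)
  qed
qed

lemma set_lebesgue_integral_call:
  assumes \<mu>: "half_line_distribution \<mu>"
  shows "(LINT x:{0..}|\<mu>. max 0 (x - K)) = (\<integral>x. max 0 (x - K) \<partial>\<mu>)"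
  unfolding set_lebesgue_integral_half_line[OF \<mu> call_payoff(1)]
proof (rule integral_cong_AE)
  note [measurable_cong] = half_line_distributionD(3)[OF \<mu>]
  show "(\<lambda>x. max 0 (max 0 x - K)) \<in> borel_measurable \<mu>" "(\<lambda>x. max 0 (x - K)) \<in> borel_measurable \<mu>"
    by measurable
  show "AE x in \<mu>. max 0 (max 0 x - K) = max 0 (x - K)"
    using half_line_distributionD(5)[OF \<mu>] by eventually_elim simp
qed

lemma cx_le_call:
  assumes le: "cx_le \<mu> \<nu>" and \<mu>: "half_line_distribution \<mu>" and \<nu>: "half_line_distribution \<nu>"
  shows "(\<integral>x. max 0 (x - K) \<partial>\<mu>) \<le> (\<integral>x. max 0 (x - K) \<partial>\<nu>)"
  using le[unfolded cx_le_def, rule_format, OF call_payoff, of K]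
  by (simp only: set_lebesgue_integral_call \<mu> \<nu>)

lemma call_tail:
  assumes \<nu>: "half_line_distribution \<nu>" and "0 < e"
  shows "\<exists>K. (\<integral>x. max 0 (x - K) \<partial>\<nu>) \<le> e"
proof -
  note [measurable_cong] = half_line_distributionD(3)[OF \<nu>]
  have "(\<lambda>n. \<integral>x. max 0 (x - real n) \<partial>\<nu>) \<longlonglongrightarrow> (\<integral>x. 0 \<partial>\<nu>)"
  proof (rule integral_dominated_convergence[where w = "\<lambda>x. \<bar>x\<bar>"])
    show "AE x in \<nu>. (\<lambda>n. max 0 (x - real n)) \<longlonglongrightarrow> 0"
    proof (intro AE_I2 tendsto_eventually)
      fix x :: real
      obtain n0 :: nat where "x \<le> real n0" using real_arch_simple by blast
      then show "\<forall>\<^sub>F n in sequentially. max 0 (x - real n) = 0"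
        by (intro eventually_sequentiallyI[of n0]) (auto simp: max_def)
    qed
    show "integrable \<nu> (\<lambda>x. \<bar>x\<bar>)"
      using half_line_distributionD(6)[OF \<nu>] by (rule integrable_abs)
    show "AE x in \<nu>. norm (max 0 (x - real n)) \<le> \<bar>x\<bar>" for n by (rule AE_I2) auto
    show "(\<lambda>x. max 0 (x - real n)) \<in> borel_measurable \<nu>" for n by measurable
  qed simp
  then have "\<forall>\<^sub>F n in sequentially. (\<integral>x. max 0 (x - real n) \<partial>\<nu>) < e"
    by (rule order_tendstoD(2)) (simp add: \<open>0 < e\<close>)
  from eventually_happens'[OF sequentially_bot this]
  obtain n :: nat where "(\<integral>x. max 0 (x - real n) \<partial>\<nu>) < e" by auto
  then show ?thesis by (intro exI[of _ "real n"]) simp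
qed

section \<open>Limits of laws dominated in the convex order\<close>

lemma (in prob_space) half_line_distribution_distr:
  fixes Z :: "'a \<Rightarrow> real"
  assumes "integrable M Z" "AE x in M. 0 \<le> Z x"
  shows "half_line_distribution (distr M borel Z)"
proof -
  have [measurable]: "random_variable borel Z" using assms(1) by auto
  show ?thesis unfolding half_line_distribution_def
    using assms by (auto simp: AE_distr_iff integrable_distr_eq)
qed

text \<open>The strike that makes the call price under \<open>\<nu>\<close> small serves every
  \<open>n\<close>, which is uniform integrability, and hence the means converge. A function of
  linear growth is then dominated by \<open>C * (1 + Z n x)\<close>, a varying majorant with
  convergent integrals.\<close>

lemma (in prob_space) cx_dominated_limit:
  fixes Z :: "nat \<Rightarrow> 'a \<Rightarrow> real"
  assumes int: "\<And>n. integrable M (Z n)" and meas [measurable]: "Z' \<in> borel_measurable M"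
    and nonneg: "\<And>n. AE x in M. 0 \<le> Z n x"
    and lim: "AE x in M. (\<lambda>n. Z n x) \<longlonglongrightarrow> Z' x"
    and le: "\<And>n. cx_le (distr M borel (Z n)) \<nu>" and \<nu>: "half_line_distribution \<nu>"
  shows "integrable M Z'" "AE x in M. 0 \<le> Z' x" "(\<lambda>n. \<integral>x. Z n x \<partial>M) \<longlonglongrightarrow> (\<integral>x. Z' x \<partial>M)"
    "cx_tendsto (\<lambda>n. distr M borel (Z n)) (distr M borel Z')"
proof -
  note [measurable] = borel_measurable_integrable[OF int]
  have nonneg_all: "AE x in M. \<forall>n. 0 \<le> Z n x" using nonneg by (simp add: AE_all_countable)
  then show nonneg': "AE x in M. 0 \<le> Z' x"
    using lim by eventually_elim (auto intro: LIMSEQ_le_const)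
  have UI: "\<exists>K. \<forall>n. (\<integral>x. max 0 (Z n x - K) \<partial>M) \<le> e" if e: "0 < e" for e
  proof -
    obtain K where K: "(\<integral>x. max 0 (x - K) \<partial>\<nu>) \<le> e" using call_tail[OF \<nu> e] by auto
    have "(\<integral>x. max 0 (Z n x - K) \<partial>M) \<le> e" for n
      using cx_le_call[OF le half_line_distribution_distr[OF int nonneg] \<nu>, of n K] K
      by (simp add: integral_distr)
    then show ?thesis by blast
  qed
  show int': "integrable M Z'" and lim_int: "(\<lambda>n. \<integral>x. Z n x \<partial>M) \<longlonglongrightarrow> (\<integral>x. Z' x \<partial>M)"
    using uniformly_integrable_limit[OF int meas nonneg lim UI] by auto
  show "cx_tendsto (\<lambda>n. distr M borel (Z n)) (distr M borel Z')"
    unfolding cx_tendsto_def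
  proof (intro allI impI)
    fix \<psi> :: "real \<Rightarrow> real"
    assume \<psi>: "continuous_on {0..} \<psi>" and "linear_growth_on norm {0..} \<psi>"
    then obtain C where C: "0 \<le> C" "\<And>x. 0 \<le> x \<Longrightarrow> \<bar>\<psi> x\<bar> \<le> C * (1 + x)"
      using linear_growth_half_lineE by blast
    have cont: "continuous_on UNIV (\<lambda>x. \<psi> (max 0 x))"
      by (intro continuous_on_compose2[OF \<psi>] continuous_intros) auto
    then have [measurable]: "(\<lambda>x. \<psi> (max 0 x)) \<in> borel_measurable borel"
      by (rule borel_measurable_continuous_onI)
    have "(\<lambda>n. \<integral>x. \<psi> (max 0 (Z n x)) \<partial>M) \<longlonglongrightarrow> (\<integral>x. \<psi> (max 0 (Z' x)) \<partial>M)"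
    proof (rule generalized_dominated_convergence)
      show "AE x in M. (\<lambda>n. \<psi> (max 0 (Z n x))) \<longlonglongrightarrow> \<psi> (max 0 (Z' x))"
        using lim
      proof eventually_elim
        case (elim x)
        with cont show ?case by (intro isCont_tendsto_compose[where g = "\<lambda>x. \<psi> (max 0 x)"])
            (auto simp: continuous_on_eq_continuous_at)
      qed
      show "AE x in M. (\<lambda>n. C * (1 + Z n x)) \<longlonglongrightarrow> C * (1 + Z' x)"
        using lim by eventually_elim (intro tendsto_intros)
      show "(\<lambda>n. \<integral>x. C * (1 + Z n x) \<partial>M) \<longlonglongrightarrow> (\<integral>x. C * (1 + Z' x) \<partial>M)"
        using int int' by (auto simp: prob_space intro!: tendsto_intros lim_int)
      show "AE x in M. \<bar>\<psi> (max 0 (Z n x))\<bar> \<le> C * (1 + Z n x)" for n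
        using nonneg[of n] by eventually_elim (auto intro: C)
    qed (use int int' in auto)
    then show "(\<lambda>n. LINT x:{0..}|distr M borel (Z n). \<psi> x) \<longlonglongrightarrow> (LINT x:{0..}|distr M borel Z'. \<psi> x)"
      by (simp add: integral_distr set_lebesgue_integral_half_line[OF _ \<psi>]
          half_line_distribution_distr int nonneg int' nonneg')
  qed
qed

text \<open>Skorohod's representation replaces weak by almost sure convergence, to which
  \<open>cx_dominated_limit\<close> applies.\<close>

lemma weak_limit_cx_dominated:
  assumes \<mu>: "\<And>n. half_line_distribution (\<mu> n)" and \<mu>': "real_distribution \<mu>'"
    and conv: "weak_conv_m \<mu> \<mu>'"
    and le: "\<And>n. cx_le (\<mu> n) \<nu>" and \<nu>: "half_line_distribution \<nu>"
  shows "half_line_distribution \<mu>'" "(\<lambda>n. \<integral>x. x \<partial>\<mu> n) \<longlonglongrightarrow> (\<integral>x. x \<partial>\<mu>')"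
    "cx_tendsto \<mu> \<mu>'"
proof -
  obtain \<Omega> :: "real measure" and Y Y' where \<Omega>: "prob_space \<Omega>"
    and Y [measurable]: "\<And>n. Y n \<in> borel_measurable \<Omega>" and distr_Y: "\<And>n. distr \<Omega> borel (Y n) = \<mu> n"
    and Y' [measurable]: "Y' \<in> borel_measurable \<Omega>" and distr_Y': "distr \<Omega> borel Y' = \<mu>'"
    and lim: "\<And>x. x \<in> space \<Omega> \<Longrightarrow> (\<lambda>n. Y n x) \<longlonglongrightarrow> Y' x"
    using Skorohod[OF half_line_distributionD(1)[OF \<mu>] \<mu>' conv] by force
  interpret prob_space \<Omega> by fact
  have int: "integrable \<Omega> (Y n)" for n
    using half_line_distributionD(6)[OF \<mu>[of n]] by (simp add: distr_Y[symmetric] integrable_distr_eq)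
  have nonneg: "AE x in \<Omega>. 0 \<le> Y n x" for n
    by (rule AE_distrD[OF Y[of n], of "\<lambda>x. 0 \<le> x", unfolded distr_Y])
       (rule half_line_distributionD(5)[OF \<mu>])
  have lim_AE: "AE x in \<Omega>. (\<lambda>n. Y n x) \<longlonglongrightarrow> Y' x" using lim by (rule AE_I2)
  note lims = cx_dominated_limit[OF int Y' nonneg lim_AE le[folded distr_Y] \<nu>]
  show "half_line_distribution \<mu>'"
    using half_line_distribution_distr[OF lims(1,2)] by (simp add: distr_Y')
  have "(\<integral>x. x \<partial>\<mu> n) = (\<integral>x. Y n x \<partial>\<Omega>)" for n
    using integral_distr[OF Y[of n], of "\<lambda>x. x"] by (simp add: distr_Y)
  moreover have "(\<integral>x. x \<partial>\<mu>') = (\<integral>x. Y' x \<partial>\<Omega>)"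
    using integral_distr[OF Y', of "\<lambda>x. x"] by (simp add: distr_Y')
  ultimately show "(\<lambda>n. \<integral>x. x \<partial>\<mu> n) \<longlonglongrightarrow> (\<integral>x. x \<partial>\<mu>')" using lims(3) by simp
  show "cx_tendsto \<mu> \<mu>'" using lims(4) by (simp add: distr_Y distr_Y')
qed

section \<open>Weak limits from call prices\<close>

lemma call_prices_determine:
  assumes \<mu>: "half_line_distribution \<mu>" and \<nu>: "half_line_distribution \<nu>"
    and eq: "\<And>K. (\<integral>x. max 0 (x - K) \<partial>\<mu>) = (\<integral>x. max 0 (x - K) \<partial>\<nu>)"
  shows "\<mu> = \<nu>"
proof -
  txt \<open>The right derivative of the call price in the strike is \<open>cdf - 1\<close>.\<close>
  have lim: "(\<lambda>n. real n * ((\<integral>x. max 0 (x - a) \<partial>m) - (\<integral>x. max 0 (x - (a + 1 / real n)) \<partial>m)))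
      \<longlonglongrightarrow> 1 - cdf m a" if m: "half_line_distribution m" for m a
  proof -
    interpret real_distribution m by (rule half_line_distributionD(1)[OF m])
    let ?f = "\<lambda>n x. real n * (max 0 (x - a) - max 0 (x - (a + 1 / real n)))"
    have int: "integrable m (\<lambda>x. max 0 (x - K))" for K
      using half_line_distributionD(6)[OF m] by simp
    \<comment> \<open>Call payoffs are 1-Lipschitz in the strike, whence the majorant 1. Approaching
      the strike from the right leaves the indicator of the open ray, the complement of the set that
      \<open>cdf\<close> measures.\<close>
    have "(\<lambda>n. \<integral>x. ?f n x \<partial>m) \<longlonglongrightarrow> (\<integral>x. indicator {a<..} x \<partial>m)"
    proof (rule integral_dominated_convergence[where w = "\<lambda>x. 1"])
      show "AE x in m. (\<lambda>n. ?f n x) \<longlonglongrightarrow> indicator {a<..} x"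
      proof (intro AE_I2 tendsto_eventually)
        fix x
        show "\<forall>\<^sub>F n in sequentially. ?f n x = indicator {a<..} x"
        proof (cases "a < x")
          case True
          then obtain n0 where n0: "inverse (real (Suc n0)) < x - a"
            using reals_Archimedean[of "x - a"] by auto
          show ?thesis
          proof (rule eventually_sequentiallyI[of "Suc n0"])
            fix n assume "Suc n0 \<le> n"
            then have "1 / real n \<le> inverse (real (Suc n0))" by (simp add: divide_simps)
            with n0 have "max 0 (x - (a + 1 / real n)) = x - (a + 1 / real n)" by linarith
            then show "?f n x = indicator {a<..} x"
              using True \<open>Suc n0 \<le> n\<close> by (simp add: field_simps)
          qed
        next
          case False
          moreover have "0 \<le> 1 / real n" for n by simp
          ultimately have "max 0 (x - a) = 0" "max 0 (x - (a + 1 / real n)) = 0" for n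
            unfolding max_def by (smt (verit))+
          then show ?thesis using False by (intro always_eventually allI) simp
        qed
      qed
      show "AE x in m. norm (?f n x) \<le> 1" for n
      proof (intro AE_I2)
        fix x
        show "norm (?f n x) \<le> 1"
        proof (cases "n = 0")
          case False
          have "0 \<le> 1 / real n" by simp
          then have "\<bar>max 0 (x - a) - max 0 (x - (a + 1 / real n))\<bar> \<le> 1 / real n"
            by arith
          then have "real n * \<bar>max 0 (x - a) - max 0 (x - (a + 1 / real n))\<bar> \<le> real n * (1 / real n)"
            by (intro mult_left_mono) auto
          then show ?thesis using False by (simp add: abs_mult)
        qed simp
      qed
    qed auto
    moreover have "(\<integral>x. ?f n x \<partial>m) =
        real n * ((\<integral>x. max 0 (x - a) \<partial>m) - (\<integral>x. max 0 (x - (a + 1 / real n)) \<partial>m))" for n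
      using int by simp
    moreover have "(\<integral>x. indicator {a<..} x \<partial>m) = 1 - cdf m a"
    proof -
      have "{a<..} = space m - {..a}" by auto
      then show ?thesis using prob_compl[of "{..a}"] by (simp add: cdf_def)
    qed
    ultimately show ?thesis by (simp only:)
  qed
  have "1 - cdf \<mu> a = 1 - cdf \<nu> a" for a
    using LIMSEQ_unique[OF lim[OF \<mu>, of a]] lim[OF \<nu>, of a] unfolding eq by blast
  then have "cdf \<mu> = cdf \<nu>" by auto
  then show ?thesis
    using cdf_unique half_line_distributionD(1)[OF \<mu>] half_line_distributionD(1)[OF \<nu>] by blast
qed

lemma cx_le_antisym:
  assumes "half_line_distribution \<mu>" "half_line_distribution \<nu>" "cx_le \<mu> \<nu>" "cx_le \<nu> \<mu>"
  shows "\<mu> = \<nu>"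
  using assms by (intro call_prices_determine antisym cx_le_call)

lemma tight_cx_dominated:
  assumes \<mu>: "\<And>n. half_line_distribution (\<mu> n)"
    and le: "\<And>n. cx_le (\<mu> n) \<nu>" and \<nu>: "half_line_distribution \<nu>"
  shows "tight \<mu>"
  unfolding tight_def
proof (intro conjI allI impI)
  fix e :: real assume "0 < e"
  define m0 where "m0 = (\<integral>x. max 0 (x - 0) \<partial>\<nu>)"
  have m0: "0 \<le> m0" unfolding m0_def by (rule Bochner_Integration.integral_nonneg) simp
  \<comment> \<open>Markov's inequality bounds the mass beyond \<open>c\<close> by
    \<open>m0 / c\<close>. The summand 1 keeps \<open>c\<close> positive when \<open>m0\<close> is 0
    and makes the bound strictly smaller than \<open>e\<close>.\<close>
  define c where "c = m0 / e + 1"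
  have c: "0 < c" "m0 / c < e" using m0 \<open>0 < e\<close> unfolding c_def by (auto simp: field_simps add_pos_nonneg)
  \<comment> \<open>The interval is open on the left; the endpoint -1 lets it contain a possible
    atom at 0.\<close>
  show "\<exists>a b. a < b \<and> (\<forall>n. 1 - e < measure (\<mu> n) {a<..b})"
  proof (rule exI[of _ "-1"], rule exI[of _ c], intro conjI allI)
    fix n
    interpret real_distribution "\<mu> n" by (rule half_line_distributionD(1)[OF \<mu>])
    have "(\<integral>x. x \<partial>\<mu> n) \<le> (\<integral>x. max 0 (x - 0) \<partial>\<mu> n)"
      using half_line_distributionD(6)[OF \<mu>[of n]] by (intro integral_mono) auto
    also have "\<dots> \<le> m0" unfolding m0_def by (rule cx_le_call[OF le \<mu> \<nu>])
    finally have "(\<integral>x. x \<partial>\<mu> n) / c \<le> m0 / c" using c by (intro divide_right_mono) auto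
    moreover have "measure (\<mu> n) {x \<in> space (\<mu> n). c \<le> x} \<le> (\<integral>x. x \<partial>\<mu> n) / c"
      using half_line_distributionD(5,6)[OF \<mu>[of n]] c
      by (intro integral_Markov_inequality_measure[where A = "{}"]) auto
    moreover have "{x \<in> space (\<mu> n). c \<le> x} = space (\<mu> n) - {..<c}" by auto
    then have "measure (\<mu> n) {x \<in> space (\<mu> n). c \<le> x} = 1 - measure (\<mu> n) {..<c}"
      using prob_compl[of "{..<c}"] by simp
    moreover have "measure (\<mu> n) {..<c} \<le> measure (\<mu> n) {-1<..c}"
      by (rule finite_measure_mono_AE)
         (use half_line_distributionD(5)[OF \<mu>[of n]] in \<open>auto elim: eventually_mono\<close>)
    ultimately show "1 - e < measure (\<mu> n) {-1<..c}" using c by linarith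
  qed (use c in simp)
qed (rule half_line_distributionD(1)[OF \<mu>])

text \<open>Tightness provides subsequential limits. Each is again dominated, so its call prices are
  the limits of the given ones; all subsequential limits thus coincide and the whole sequence
  converges.\<close>

lemma cx_dominated_weak_limit_exists:
  assumes \<mu>: "\<And>n. half_line_distribution (\<mu> n)"
    and le: "\<And>n. cx_le (\<mu> n) \<nu>" and \<nu>: "half_line_distribution \<nu>"
    and conv: "\<And>K. convergent (\<lambda>n. \<integral>x. max 0 (x - K) \<partial>\<mu> n)"
  shows "\<exists>\<mu>'. real_distribution \<mu>' \<and> weak_conv_m \<mu> \<mu>'"
proof -
  have tight: "tight \<mu>" by (rule tight_cx_dominated[OF \<mu> le \<nu>])
  obtain r M where r: "strict_mono r" and M: "real_distribution M" and rM: "weak_conv_m (\<mu> \<circ> r) M"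
    using tight_imp_convergent_subsubsequence[OF tight strict_mono_id] by auto
  have calls: "(\<integral>x. max 0 (x - K) \<partial>\<kappa>) = lim (\<lambda>n. \<integral>x. max 0 (x - K) \<partial>\<mu> n)"
    and half_line: "half_line_distribution \<kappa>"
    if s: "strict_mono s" and \<kappa>: "real_distribution \<kappa>" and w: "weak_conv_m (\<mu> \<circ> s) \<kappa>" for s \<kappa> K
  proof -
    have h: "half_line_distribution ((\<mu> \<circ> s) n)" and l: "cx_le ((\<mu> \<circ> s) n) \<nu>" for n
      using \<mu> le by auto
    note W = weak_limit_cx_dominated[OF h \<kappa> w l \<nu>]
    show \<kappa>': "half_line_distribution \<kappa>" by (rule W(1))
    have "(\<lambda>n. \<integral>x. max 0 (x - K) \<partial>\<mu> (s n)) \<longlonglongrightarrow> (\<integral>x. max 0 (x - K) \<partial>\<kappa>)"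
      using W(3)[unfolded cx_tendsto_def, rule_format, OF call_payoff(1,3), of K] by (simp add: set_lebesgue_integral_call \<mu> \<kappa>')
    moreover have "(\<lambda>n. \<integral>x. max 0 (x - K) \<partial>\<mu> (s n)) \<longlonglongrightarrow> lim (\<lambda>n. \<integral>x. max 0 (x - K) \<partial>\<mu> n)"
      using LIMSEQ_subseq_LIMSEQ[OF convergent_LIMSEQ_iff[THEN iffD1, OF conv] s] by (simp add: o_def)
    ultimately show "(\<integral>x. max 0 (x - K) \<partial>\<kappa>) = lim (\<lambda>n. \<integral>x. max 0 (x - K) \<partial>\<mu> n)"
      by (rule LIMSEQ_unique)
  qed
  have "weak_conv_m \<mu> M"
  proof (rule tight_subseq_weak_converge[OF half_line_distributionD(1)[OF \<mu>] M tight])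
    fix s \<kappa> assume s: "strict_mono s" "real_distribution \<kappa>" "weak_conv_m (\<mu> \<circ> s) \<kappa>"
    have "\<kappa> = M"
      by (rule call_prices_determine[OF half_line[OF s] half_line[OF r M rM]])
         (simp only: calls[OF s] calls[OF r M rM])
    with s show "weak_conv_m (\<mu> \<circ> s) M" by simp
  qed
  with M show ?thesis by blast
qed

text \<open>Monotone call prices, bounded by those of \<open>\<nu>\<close>, converge. The
  disjunction covers the increasing bids and the decreasing asks together.\<close>

lemma cx_monotone_weak_limit_exists:
  assumes \<mu>: "\<And>n. half_line_distribution (\<mu> n)"
    and le: "\<And>n. cx_le (\<mu> n) \<nu>" and \<nu>: "half_line_distribution \<nu>"
    and mono: "(\<forall>n m. n \<le> m \<longrightarrow> cx_le (\<mu> n) (\<mu> m)) \<or> (\<forall>n m. n \<le> m \<longrightarrow> cx_le (\<mu> m) (\<mu> n))"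
  shows "\<exists>\<mu>'. weak_conv_m \<mu> \<mu>' \<and> half_line_distribution \<mu>' \<and>
    (\<lambda>n. \<integral>x. x \<partial>\<mu> n) \<longlonglongrightarrow> (\<integral>x. x \<partial>\<mu>') \<and> cx_tendsto \<mu> \<mu>'"
proof -
  have "convergent (\<lambda>n. \<integral>x. max 0 (x - K) \<partial>\<mu> n)" for K
  proof (rule Bseq_monoseq_convergent)
    show "Bseq (\<lambda>n. \<integral>x. max 0 (x - K) \<partial>\<mu> n)"
    proof (rule BseqI')
      fix n
      have "0 \<le> (\<integral>x. max 0 (x - K) \<partial>\<mu> n)" by (rule Bochner_Integration.integral_nonneg) simp
      then show "norm (\<integral>x. max 0 (x - K) \<partial>\<mu> n) \<le> (\<integral>x. max 0 (x - K) \<partial>\<nu>)"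
        using cx_le_call[OF le[of n] \<mu> \<nu>, of K] by simp
    qed
    show "monoseq (\<lambda>n. \<integral>x. max 0 (x - K) \<partial>\<mu> n)"
      using mono cx_le_call[OF _ \<mu> \<mu>] unfolding monoseq_def by blast
  qed
  from cx_dominated_weak_limit_exists[OF \<mu> le \<nu> this]
  obtain \<mu>' where "real_distribution \<mu>'" and w: "weak_conv_m \<mu> \<mu>'" by blast
  then show ?thesis using weak_limit_cx_dominated[OF \<mu> _ w le \<nu>] by blast
qed

section \<open>Almost sure representation in the orthant\<close>

lemma space_orthant_algebra: "space (orthant_algebra N) = orthant N"
  by (simp add: orthant_algebra_def space_PiM space_restrict_space)

lemma measurable_orthant_component [measurable]:
  assumes "i \<in> {1..N}"
  shows "(\<lambda>\<omega>. \<omega> i) \<in> borel_measurable (orthant_algebra N)"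
proof -
  have "(\<lambda>\<omega>. \<omega> i) \<in> orthant_algebra N \<rightarrow>\<^sub>M restrict_space borel {0..}"
    unfolding orthant_algebra_def by (rule measurable_component_singleton[OF assms])
  then show ?thesis by (rule measurable_compose) (simp add: measurable_restrict_space1)
qed

lemma measurable_restrict_orthant:
  assumes "\<And>i. i \<in> {1..N} \<Longrightarrow> (\<lambda>x. f x i) \<in> borel_measurable M" "\<And>i x. i \<in> {1..N} \<Longrightarrow> 0 \<le> f x i"
  shows "(\<lambda>x. restrict (f x) {1..N}) \<in> M \<rightarrow>\<^sub>M orthant_algebra N"
  unfolding orthant_algebra_def
  by (intro measurable_restrict measurable_restrict_space2) (use assms in auto)

text \<open>Prokhorov's and Skorohod's theorems on the orthant, obtained on the line: the codes have
  tight laws, a subsequence of them is represented by almost surely convergent variables, and the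
  continuous curve decodes these coordinate by coordinate. Bounded means are what keeps the decoded
  limit finite.\<close>

lemma orthant_as_convergent_subsequence:
  fixes Q :: "nat \<Rightarrow> (nat \<Rightarrow> real) measure"
  assumes Q: "\<And>n. prob_space (Q n)" and sets_Q [measurable_cong]: "\<And>n. sets (Q n) = sets (orthant_algebra N)"
    and int: "\<And>n i. i \<in> {1..N} \<Longrightarrow> integrable (Q n) (\<lambda>\<omega>. \<omega> i)"
    and bound: "\<And>n i. i \<in> {1..N} \<Longrightarrow> (\<integral>\<omega>. \<omega> i \<partial>Q n) \<le> C"
  obtains r :: "nat \<Rightarrow> nat" and M :: "real measure" and Z :: "nat \<Rightarrow> real \<Rightarrow> nat \<Rightarrow> real" and Z'
  where "strict_mono r" "prob_space M" "\<And>n. Z n \<in> M \<rightarrow>\<^sub>M orthant_algebra N"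
    "Z' \<in> M \<rightarrow>\<^sub>M orthant_algebra N" "\<And>n. distr M (orthant_algebra N) (Z n) = Q (r n)"
    "\<And>i. i \<in> {1..N} \<Longrightarrow> AE x in M. (\<lambda>n. Z n x i) \<longlonglongrightarrow> Z' x i"
proof -
  have space_Q: "space (Q n) = orthant N" for n
    using sets_eq_imp_space_eq[OF sets_Q] by (simp add: space_orthant_algebra)
  \<comment> \<open>Squeezes the half-line into [0, 1), where binary expansions are faithful. The
    value 0 outside \<open>{1..N}\<close> keeps all of the countably many coordinates
    measurable.\<close>
  define u :: "(nat \<Rightarrow> real) \<Rightarrow> nat \<Rightarrow> real"
    where "u \<omega> j = (if j \<in> {1..N} then \<omega> j / (1 + \<omega> j) else 0)" for \<omega> j
  define c where "c \<omega> = schoenberg_code (u \<omega>)" for \<omega>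
  have c [measurable]: "c \<in> borel_measurable (Q n)" for n
    unfolding c_def
  proof (rule measurable_schoenberg_code)
    fix j
    show "(\<lambda>\<omega>. u \<omega> j) \<in> borel_measurable (Q n)"
    proof (cases "j \<in> {1..N}")
      case True
      note [measurable] = measurable_orthant_component[OF True]
      show ?thesis unfolding u_def using True by simp measurable
    qed (auto simp: u_def)
  qed
  have curve_c: "schoenberg_curve (c \<omega>) j = \<omega> j / (1 + \<omega> j)" if "\<omega> \<in> orthant N" "j \<in> {1..N}" for \<omega> j
  proof -
    have "0 \<le> \<omega> j" using that by auto
    then have "0 \<le> u \<omega> j" "u \<omega> j < 1" using that by (auto simp: u_def divide_simps)
    then show ?thesis unfolding c_def using schoenberg_curve_code[of "u \<omega>" j] that by (simp add: u_def)
  qed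
  have curve_meas [measurable]: "(\<lambda>t. schoenberg_curve t j) \<in> borel_measurable borel" for j
    by (rule borel_measurable_continuous_onI[OF continuous_on_schoenberg_curve])
  define P where "P n = distr (Q n) borel c" for n
  have P: "real_distribution (P n)" for n
    unfolding P_def using prob_space.real_distribution_distr[OF Q c] .
  have "tight P"
    unfolding tight_def
  proof (intro conjI allI impI P)
    fix e :: real assume "0 < e"
    have "measure (P n) {-1<..1} = 1" for n
    proof -
      interpret prob_space "Q n" by (rule Q)
      have "- 1 < c \<omega>" for \<omega> unfolding c_def using schoenberg_code_bounds(1)[of "u \<omega>"] by linarith
      then have "c -` {-1<..1} \<inter> space (Q n) = space (Q n)"
        using schoenberg_code_bounds by (auto simp: c_def)
      then show ?thesis unfolding P_def by (simp add: measure_distr prob_space)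
    qed
    then have "- 1 < (1 :: real) \<and> (\<forall>n. 1 - e < measure (P n) {- 1<..1})" using \<open>0 < e\<close> by simp
    then show "\<exists>a b. a < b \<and> (\<forall>n. 1 - e < measure (P n) {a<..b})" by blast
  qed
  from tight_imp_convergent_subsubsequence[OF this strict_mono_id]
  obtain r P' where r: "strict_mono r" and P': "real_distribution P'" and conv: "weak_conv_m (P \<circ> r) P'"
    by auto
  obtain M :: "real measure" and Y Y' where M: "prob_space M"
    and Y [measurable]: "\<And>n. Y n \<in> borel_measurable M" and distr_Y: "\<And>n. distr M borel (Y n) = P (r n)"
    and Y' [measurable]: "Y' \<in> borel_measurable M"
    and lim: "\<And>x. x \<in> space M \<Longrightarrow> (\<lambda>n. Y n x) \<longlonglongrightarrow> Y' x"
    using Skorohod[of "P \<circ> r" P', OF _ P' conv] P by force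
  interpret prob_space M by (rule M)
  define V where "V n x i = schoenberg_curve (Y n x) i" for n x i
  define V' where "V' x i = schoenberg_curve (Y' x) i" for x i
  have [measurable]: "(\<lambda>x. V n x i) \<in> borel_measurable M" "(\<lambda>x. V' x i) \<in> borel_measurable M" for n i
    unfolding V_def V'_def by measurable
  have V01: "0 \<le> V n x i" "V n x i \<le> 1" "0 \<le> V' x i" "V' x i \<le> 1" for n x i
    unfolding V_def V'_def by (simp_all add: schoenberg_curve_bounds)
  have lim_V: "(\<lambda>n. V n x i) \<longlonglongrightarrow> V' x i" if "x \<in> space M" for x i
    unfolding V_def V'_def using continuous_on_schoenberg_curve[of i] lim[OF that]
    by (intro isCont_tendsto_compose[where g = "\<lambda>t. schoenberg_curve t i"])
       (auto simp: continuous_on_eq_continuous_at)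
  \<comment> \<open>Inverts z / (1 + z). At curve value 1 the quotient is 0 by the convention for
    division by zero, so \<open>G\<close> always lands in the orthant; \<open>V'_less\<close> shows
    that the limit almost surely avoids this value.\<close>
  define G :: "real \<Rightarrow> nat \<Rightarrow> real"
    where "G t = restrict (\<lambda>j. schoenberg_curve t j / (1 - schoenberg_curve t j)) {1..N}" for t
  have G [measurable]: "G \<in> borel \<rightarrow>\<^sub>M orthant_algebra N"
    unfolding G_def by (rule measurable_restrict_orthant) (auto simp: schoenberg_curve_bounds)
  have G_c: "G (c \<omega>) = \<omega>" if "\<omega> \<in> orthant N" for \<omega>
  proof
    fix j
    show "G (c \<omega>) j = \<omega> j"
    proof (cases "j \<in> {1..N}")
      case True
      then have "0 \<le> \<omega> j" using that by auto
      then have "1 - \<omega> j / (1 + \<omega> j) = 1 / (1 + \<omega> j)" by (simp add: field_simps)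
      then show ?thesis unfolding G_def using True \<open>0 \<le> \<omega> j\<close> by (simp add: curve_c[OF that])
    next
      case False
      then show ?thesis unfolding G_def using that by (auto simp: PiE_def extensional_def)
    qed
  qed
  \<comment> \<open>\<open>Y n\<close> has the law of the code under \<open>Q (r n)\<close>, and
    \<open>G\<close> undoes the code on the orthant, so the full joint law is recovered and not just
    its marginals.\<close>
  have distr_G: "distr M (orthant_algebra N) (\<lambda>x. G (Y n x)) = Q (r n)" for n
  proof -
    have "distr M (orthant_algebra N) (\<lambda>x. G (Y n x)) = distr (distr M borel (Y n)) (orthant_algebra N) G"
      by (subst distr_distr) (auto simp: comp_def)
    also have "\<dots> = distr (Q (r n)) (orthant_algebra N) (\<lambda>\<omega>. G (c \<omega>))"
      unfolding distr_Y P_def by (subst distr_distr) (auto simp: comp_def)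
    also have "\<dots> = distr (Q (r n)) (Q (r n)) (\<lambda>\<omega>. \<omega>)"
      by (rule distr_cong) (auto simp: sets_Q space_Q G_c)
    also have "\<dots> = Q (r n)" by (rule distr_id)
    finally show ?thesis .
  qed
  txt \<open>With \<open>v = z / (1 + z)\<close> the test function \<open>max 0 (1 - L * (1 - v))\<close> is at most \<open>z / L\<close>, so the
    bounded means keep the limit away from the point \<open>v = 1\<close> at infinity.\<close>
  have V'_less: "AE x in M. V' x i < 1" if i: "i \<in> {1..N}" for i
  proof -
    define f where "f L v = max 0 (1 - L * (1 - v))" for L v :: real
    have f_bound: "norm (f L v) \<le> 1" if "0 \<le> L" "v \<le> 1" for L v
      using that unfolding f_def by (auto simp: max_def)
    have [measurable]: "f L \<in> borel_measurable borel" for L unfolding f_def by measurable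
    have small: "measure M {x \<in> space M. V' x i \<ge> 1} \<le> C / L" if L: "1 \<le> L" for L
    proof -
      have "(\<integral>x. f L (V n x i) \<partial>M) \<le> C / L" for n
      proof -
        interpret Q: prob_space "Q (r n)" by (rule Q)
        have "(\<integral>x. f L (V n x i) \<partial>M) = (\<integral>t. f L (schoenberg_curve t i) \<partial>distr M borel (Y n))"
          unfolding V_def by (subst integral_distr) auto
        also have "\<dots> = (\<integral>\<omega>. f L (schoenberg_curve (c \<omega>) i) \<partial>Q (r n))"
          unfolding distr_Y P_def by (subst integral_distr) auto
        also have "\<dots> \<le> (\<integral>\<omega>. \<omega> i / L \<partial>Q (r n))"
        proof (rule integral_mono)
          have "AE \<omega> in Q (r n). norm (f L (schoenberg_curve (c \<omega>) i)) \<le> 1"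
            using L by (intro AE_I2 f_bound schoenberg_curve_bounds) auto
          then show "integrable (Q (r n)) (\<lambda>\<omega>. f L (schoenberg_curve (c \<omega>) i))"
            by (rule Q.integrable_const_bound) measurable
          fix \<omega> assume "\<omega> \<in> space (Q (r n))"
          then have w: "\<omega> \<in> orthant N" "0 \<le> \<omega> i" using i by (auto simp: space_Q)
          \<comment> \<open>Here 1 - v = 1 / (1 + z). The left side is negative when
            \<open>1 + \<omega> i < L\<close>; otherwise enlarging the numerator and shrinking the
            denominator to \<open>L\<close> gives the bound.\<close>
          have "1 - L * (1 - \<omega> i / (1 + \<omega> i)) \<le> \<omega> i / L"
          proof (cases "L \<le> 1 + \<omega> i")
            case True
            have "1 - L * (1 - \<omega> i / (1 + \<omega> i)) = (\<omega> i + 1 - L) / (1 + \<omega> i)"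
              using w by (simp add: field_simps)
            also have "\<dots> \<le> \<omega> i / (1 + \<omega> i)" using w L by (intro divide_right_mono) auto
            also have "\<dots> \<le> \<omega> i / L" using w L True by (intro divide_left_mono) auto
            finally show ?thesis .
          next
            case False
            then have "1 \<le> L * (1 / (1 + \<omega> i))" using w by (simp add: field_simps)
            moreover have "1 - \<omega> i / (1 + \<omega> i) = 1 / (1 + \<omega> i)" using w by (simp add: field_simps)
            moreover have "0 \<le> \<omega> i / L" using w L by simp
            ultimately show ?thesis by simp
          qed
          then show "f L (schoenberg_curve (c \<omega>) i) \<le> \<omega> i / L"
            unfolding curve_c[OF w(1) i] f_def using w L by simp
        qed (use int[OF i] in auto)
        also have "\<dots> = (\<integral>\<omega>. \<omega> i \<partial>Q (r n)) / L" by simp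
        also have "\<dots> \<le> C / L" using bound[OF i] L by (intro divide_right_mono) auto
        finally show ?thesis .
      qed
      moreover have "(\<lambda>n. \<integral>x. f L (V n x i) \<partial>M) \<longlonglongrightarrow> (\<integral>x. f L (V' x i) \<partial>M)"
      proof (rule integral_dominated_convergence[where w = "\<lambda>_. 1"])
        show "AE x in M. (\<lambda>n. f L (V n x i)) \<longlonglongrightarrow> f L (V' x i)"
          unfolding f_def by (intro AE_I2 tendsto_intros lim_V)
        show "AE x in M. norm (f L (V n x i)) \<le> 1" for n
          using L V01 by (intro AE_I2 f_bound) auto
      qed auto
      ultimately have le: "(\<integral>x. f L (V' x i) \<partial>M) \<le> C / L"
        by (intro LIMSEQ_le_const2) auto
      \<comment> \<open>\<open>f L\<close> takes the value 1 at the point 1, so for every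
        \<open>L\<close> it dominates the indicator of escape to infinity.\<close>
      have "measure M {x \<in> space M. V' x i \<ge> 1} = (\<integral>x. indicator {x \<in> space M. V' x i \<ge> 1} x \<partial>M)"
        by simp
      also have "\<dots> \<le> (\<integral>x. f L (V' x i) \<partial>M)"
      proof (rule integral_mono)
        have "AE x in M. norm (f L (V' x i)) \<le> 1"
          using L V01 by (intro AE_I2 f_bound) auto
        then show "integrable M (\<lambda>x. f L (V' x i))"
          by (rule integrable_const_bound) measurable
        show "integrable M (indicator {x \<in> space M. V' x i \<ge> 1} :: real \<Rightarrow> real)"
          by (rule integrable_real_indicator) (auto simp: emeasure_eq_measure)
        fix x
        show "indicator {x \<in> space M. V' x i \<ge> 1} x \<le> f L (V' x i)"
          using V01(4)[of x i] by (auto simp: f_def indicator_def)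
      qed
      finally show ?thesis using le by linarith
    qed
    have "(\<lambda>n. C / real (Suc n)) \<longlonglongrightarrow> 0"
      using tendsto_mult[OF tendsto_const LIMSEQ_inverse_real_of_nat, of C] by (simp add: divide_inverse)
    then have "measure M {x \<in> space M. V' x i \<ge> 1} \<le> 0"
      by (rule LIMSEQ_le_const) (use small[of "real (Suc _)"] in auto)
    then have "measure M {x \<in> space M. V' x i \<ge> 1} = 0" by (simp add: measure_le_0_iff)
    then have "AE x in M. x \<notin> {x \<in> space M. V' x i \<ge> 1}"
      by (subst AE_iff_measurable[OF _ refl]) (auto simp: emeasure_eq_measure)
    then show ?thesis by (rule AE_mp) (auto intro: AE_I2)
  qed
  show thesis
  proof (rule that[OF r M _ _ distr_G])
    show "(\<lambda>x. G (Y n x)) \<in> M \<rightarrow>\<^sub>M orthant_algebra N" "(\<lambda>x. G (Y' x)) \<in> M \<rightarrow>\<^sub>M orthant_algebra N" for n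
      by measurable
    fix i assume i: "i \<in> {1..N}"
    show "AE x in M. (\<lambda>n. G (Y n x) i) \<longlonglongrightarrow> G (Y' x) i"
      using V'_less[OF i] AE_space
    proof eventually_elim
      case (elim x)
      have "(\<lambda>n. V n x i / (1 - V n x i)) \<longlonglongrightarrow> V' x i / (1 - V' x i)"
        using elim by (intro tendsto_intros lim_V) auto
      then show ?case unfolding G_def V_def V'_def using i by simp
    qed
  qed
qed

section \<open>Limits of martingale measures\<close>

lemma space_natural_filtration [simp]: "space (natural_filtration \<Omega> X i) = \<Omega>"
  unfolding natural_filtration_def by (rule space_measure_of) auto

lemma sets_natural_filtration:
  "sets (natural_filtration \<Omega> X i) = sigma_sets \<Omega> {X j -` A \<inter> \<Omega> |j A. j \<le> i \<and> A \<in> sets borel}"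
  unfolding natural_filtration_def by (rule sets_measure_of) auto

lemma measurable_natural_filtration:
  assumes "j \<le> i"
  shows "X j \<in> borel_measurable (natural_filtration \<Omega> X i)"
  by (rule measurableI) (use assms in \<open>auto simp: sets_natural_filtration intro!: sigma_sets.Basic\<close>)

text \<open>Conditional expectations do not pass to limits in law, whereas integral identities
  against suitable test functions do.\<close>

lemma (in prob_space) martingale_upto_test:
  assumes mart: "martingale_upto N M F X" and ij: "i \<le> j" "j \<le> N"
    and f: "f \<in> borel_measurable (F i)" and bound: "\<And>x. \<bar>f x\<bar> \<le> (B :: real)"
  shows "(\<integral>x. f x * X j x \<partial>M) = (\<integral>x. f x * X i x \<partial>M)"
proof -
  have sub: "subalgebra M (F i)" and int: "integrable M (X j)" "integrable M (X i)"
    and cond: "AE x in M. real_cond_exp M (F i) (X j) x = X i x"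
    using mart ij unfolding martingale_upto_def by auto
  interpret finite_measure_subalgebra M "F i" by unfold_locales (rule sub)
  interpret sigma_finite_subalgebra M "F i"
    by (rule finite_measure_subalgebra_is_sigma_finite) unfold_locales
  have fM [measurable]: "f \<in> borel_measurable M" by (rule measurable_from_subalg[OF sub f])
  note [measurable] = borel_measurable_integrable[OF int(1)] borel_measurable_integrable[OF int(2)]
  have int_f: "integrable M (\<lambda>x. f x * X j x)"
  proof (rule Bochner_Integration.integrable_bound)
    show "integrable M (\<lambda>x. B * X j x)" using int by simp
    have "0 \<le> B" using bound[of undefined] by linarith
    then show "AE x in M. norm (f x * X j x) \<le> norm (B * X j x)"
      by (intro AE_I2) (simp add: abs_mult mult_right_mono bound)
  qed simp
  have "(\<integral>x. f x * X j x \<partial>M) = (\<integral>x. f x * real_cond_exp M (F i) (X j) x \<partial>M)"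
    by (rule real_cond_exp_intg(2)[OF int_f f, symmetric]) simp
  also have "\<dots> = (\<integral>x. f x * X i x \<partial>M)"
    by (rule integral_cong_AE) (use cond in auto)
  finally show ?thesis .
qed

text \<open>Boxes bound all coordinates up to time \<open>i\<close> at once and are stable under
  intersection, which events about a single time are not. Such an event
  \<open>X j \<omega> \<le> b\<close> is recovered as a countable union of boxes by letting the
  other bounds grow.\<close>

lemma natural_filtration_boxes:
  "sets (natural_filtration \<Omega> X i) \<subseteq> sigma_sets \<Omega> (range (\<lambda>a. {\<omega> \<in> \<Omega>. \<forall>k\<le>i. X k \<omega> \<le> a k}))"
  (is "_ \<subseteq> sigma_sets \<Omega> ?G")
  unfolding sets_natural_filtration
proof (rule sigma_sets_mono, safe)
  fix j A assume "j \<le> i" and A: "A \<in> sets (borel :: real measure)"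
  have G: "?G \<subseteq> Pow \<Omega>" by auto
  have "X j \<in> borel_measurable (sigma \<Omega> ?G)"
  proof (rule borel_measurableI_le)
    fix b :: real
    have eq: "{\<omega> \<in> \<Omega>. X j \<omega> \<le> b} = (\<Union>n::nat. {\<omega> \<in> \<Omega>. \<forall>k\<le>i. X k \<omega> \<le> (if k = j then b else real n)})"
      (is "?L = (\<Union>n. ?R n)")
    proof
      show "?L \<subseteq> (\<Union>n. ?R n)"
      proof
        fix \<omega> assume \<omega>: "\<omega> \<in> ?L"
        obtain n :: nat where n: "Max ((\<lambda>k. X k \<omega>) ` {..i}) \<le> real n" using real_arch_simple by blast
        have "X k \<omega> \<le> real n" if "k \<le> i" for k
          using that by (intro order_trans[OF Max_ge n]) auto
        then show "\<omega> \<in> (\<Union>n. ?R n)" using \<omega> by auto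
      qed
      show "(\<Union>n. ?R n) \<subseteq> ?L" using \<open>j \<le> i\<close> by fastforce
    qed
    have "?R n \<in> sets (sigma \<Omega> ?G)" for n
      unfolding sets_measure_of[OF G] by (rule sigma_sets.Basic) (rule rangeI)
    then show "{\<omega> \<in> space (sigma \<Omega> ?G). X j \<omega> \<le> b} \<in> sets (sigma \<Omega> ?G)"
      unfolding space_measure_of[OF G] eq by (intro sets.countable_nat_UN image_subsetI)
  qed
  from measurable_sets[OF this A] show "X j -` A \<inter> \<Omega> \<in> sigma_sets \<Omega> ?G"
    by (simp add: sets_measure_of[OF G] space_measure_of[OF G])
qed

text \<open>A Dynkin argument over the boxes. With real bounds the whole space need not be a box, so
  equality of the total integrals is assumed separately; it serves the step for complements.\<close>

lemma (in prob_space) martingale_uptoI_boxes: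
  fixes X :: "nat \<Rightarrow> 'a \<Rightarrow> real"
  assumes sub: "\<And>i. i \<le> N \<Longrightarrow> subalgebra M (natural_filtration (space M) X i)"
    and int: "\<And>i. i \<le> N \<Longrightarrow> integrable M (X i)"
    and total: "\<And>i j. i \<le> j \<Longrightarrow> j \<le> N \<Longrightarrow> (\<integral>x. X j x \<partial>M) = (\<integral>x. X i x \<partial>M)"
    and boxes: "\<And>i j a. i \<le> j \<Longrightarrow> j \<le> N \<Longrightarrow>
      (LINT x:{x \<in> space M. \<forall>k\<le>i. X k x \<le> a k}|M. X j x) = (LINT x:{x \<in> space M. \<forall>k\<le>i. X k x \<le> a k}|M. X i x)"
  shows "martingale_upto N M (natural_filtration (space M) X) X"
  unfolding martingale_upto_def
proof (intro conjI allI impI sub int)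
  show "X i \<in> borel_measurable (natural_filtration (space M) X i)" for i
    by (rule measurable_natural_filtration) simp
  fix i j assume ij: "i \<le> j" "j \<le> N"
  let ?F = "natural_filtration (space M) X i"
  let ?G = "range (\<lambda>a. {x \<in> space M. \<forall>k\<le>i. X k x \<le> a k})"
  have subi: "subalgebra M ?F" using sub ij by auto
  interpret finite_measure_subalgebra M ?F by unfold_locales (rule subi)
  interpret sigma_finite_subalgebra M ?F
    by (rule finite_measure_subalgebra_is_sigma_finite) unfold_locales
  have intj: "integrable M (X j)" and inti: "integrable M (X i)" using int ij by auto
  have GF: "sigma_sets (space M) ?G \<subseteq> sets ?F"
  proof -
    have "{x \<in> space ?F. \<forall>k\<le>i. X k x \<le> a k} \<in> sets ?F" for a
    proof -
      have [measurable]: "X k \<in> borel_measurable ?F" if "k \<in> {..i}" for k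
        using that by (intro measurable_natural_filtration) auto
      have "{x \<in> space ?F. \<forall>k\<in>{..i}. X k x \<le> a k} \<in> sets ?F" by measurable
      then show ?thesis by (simp only: Ball_def atMost_iff)
    qed
    then have "?G \<subseteq> sets ?F" unfolding space_natural_filtration by (rule image_subsetI)
    from sets.sigma_sets_subset[OF this] show ?thesis by simp
  qed
  have FM: "sets ?F \<subseteq> sets M" using subi by (simp add: subalgebra_def)
  have setint: "set_integrable M A f" if "A \<in> sets ?F" "integrable M f" for A and f :: "'a \<Rightarrow> real"
    using that FM unfolding set_integrable_def by (intro integrable_mult_indicator) auto
  have stable: "Int_stable ?G"
  proof (rule Int_stableI_image)
    fix a b :: "nat \<Rightarrow> real"
    have "{x \<in> space M. \<forall>k\<le>i. X k x \<le> a k} \<inter> {x \<in> space M. \<forall>k\<le>i. X k x \<le> b k}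
        = {x \<in> space M. \<forall>k\<le>i. X k x \<le> min (a k) (b k)}" by auto
    then show "\<exists>c\<in>UNIV. {x \<in> space M. \<forall>k\<le>i. X k x \<le> a k} \<inter> {x \<in> space M. \<forall>k\<le>i. X k x \<le> b k}
        = {x \<in> space M. \<forall>k\<le>i. X k x \<le> c k}"
      by (intro bexI[of _ "\<lambda>k. min (a k) (b k)"]) simp_all
  qed
  have subG: "?G \<subseteq> Pow (space M)" by auto
  show "AE x in M. real_cond_exp M ?F (X j) x = X i x"
  proof (rule real_cond_exp_charact[OF _ intj inti])
    show "X i \<in> borel_measurable ?F" by (rule measurable_natural_filtration) simp
    fix A assume "A \<in> sets ?F"
    then have "A \<in> sigma_sets (space M) ?G" using natural_filtration_boxes by blast
    with stable subG show "(LINT x:A|M. X j x) = (LINT x:A|M. X i x)"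
    proof (induction rule: sigma_sets_induct_disjoint)
      case (basic A)
      then show ?case using boxes[OF ij] by auto
    next
      case empty
      show ?case by (simp add: set_lebesgue_integral_def)
    next
      case (compl A)
      then have A: "A \<in> sets ?F" using GF by auto
      have "(LINT x:(space M - A)|M. f x) = (\<integral>x. f x \<partial>M) - (LINT x:A|M. f x)"
        if "integrable M f" for f :: "'a \<Rightarrow> real"
      proof -
        have "(LINT x:(space M - A)|M. f x) = (\<integral>x. f x - indicator A x *\<^sub>R f x \<partial>M)"
          unfolding set_lebesgue_integral_def
          by (rule Bochner_Integration.integral_cong) (auto simp: indicator_def)
        then show ?thesis
          using that setint[OF A that] by (simp add: set_lebesgue_integral_def set_integrable_def)
      qed
      then show ?case using compl intj inti total[OF ij] by simp
    next
      case (union A)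
      then have A: "A n \<in> sets ?F" for n using GF by auto
      have AU: "(\<Union>n. A n) \<in> sets ?F" using A by auto
      have "(LINT x:(\<Union>n. A n)|M. f x) = (\<Sum>n. LINT x:A n|M. f x)" if "integrable M f" for f :: "'a \<Rightarrow> real"
        by (rule lebesgue_integral_countable_add)
           (use A FM union(1) setint[OF AU that] in \<open>auto simp: disjoint_family_on_def\<close>)
      then show ?case using union intj inti by simp
    qed
  qed
qed

section \<open>Passing the martingale property to an almost sure limit\<close>

lemma canonical_process_simps [simp]:
  "canonical_process x0 0 \<omega> = x0" "i \<noteq> 0 \<Longrightarrow> canonical_process x0 i \<omega> = \<omega> i"
  by (simp_all add: canonical_process_def)

lemma measurable_canonical_process:
  assumes "i \<le> N"
  shows "canonical_process x0 i \<in> borel_measurable (orthant_algebra N)"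
proof (cases "i = 0")
  case True
  then show ?thesis by (simp add: canonical_process_def[abs_def])
next
  case False
  then have "(\<lambda>\<omega>. \<omega> i) \<in> borel_measurable (orthant_algebra N)"
    using assms by (intro measurable_orthant_component) auto
  then show ?thesis using False by (simp add: canonical_process_def[abs_def])
qed

text \<open>The test functions f are products of continuous [0, 1]-valued functions of X_0, ...,
  X_i. Then f X_l converges almost surely and is dominated by X_l, whose means converge, so E[f X_j]
  = E[f X_i] survives the limit. That X_l is a majorant rests on its nonnegativity, for l = 0 on
  \<open>0 \<le> x0\<close>.\<close>

lemma martingale_measure_limit:
  fixes Z :: "nat \<Rightarrow> 'a \<Rightarrow> nat \<Rightarrow> real"
  assumes M: "prob_space M" and "0 \<le> x0"
    and Z: "\<And>n. Z n \<in> M \<rightarrow>\<^sub>M orthant_algebra N" and Z': "Z' \<in> M \<rightarrow>\<^sub>M orthant_algebra N"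
    and mart: "\<And>n. martingale_measure N x0 (distr M (orthant_algebra N) (Z n))"
    and lim: "\<And>i. i \<in> {1..N} \<Longrightarrow> AE x in M. (\<lambda>n. Z n x i) \<longlonglongrightarrow> Z' x i"
    and int: "\<And>i. i \<in> {1..N} \<Longrightarrow> integrable M (\<lambda>x. Z' x i)"
    and lim_int: "\<And>i. i \<in> {1..N} \<Longrightarrow> (\<lambda>n. \<integral>x. Z n x i \<partial>M) \<longlonglongrightarrow> (\<integral>x. Z' x i \<partial>M)"
  shows "martingale_measure N x0 (distr M (orthant_algebra N) Z')"
proof -
  interpret prob_space M by (rule M)
  note [measurable] = Z Z' measurable_canonical_process
  let ?O = "orthant_algebra N" and ?X = "canonical_process x0"
  let ?F = "natural_filtration (orthant N) ?X"
  define Q where "Q n = distr M ?O (Z n)" for n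
  define Q' where "Q' = distr M ?O Z'"
  have Q: "prob_space (Q n)" and Q': "prob_space Q'" for n
    unfolding Q_def Q'_def by (simp_all add: prob_space_distr)
  interpret Q: prob_space "Q n" for n by (rule Q)
  interpret Q': prob_space Q' by (rule Q')
  have sets_Q [simp, measurable_cong]: "sets (Q n) = sets ?O" "sets Q' = sets ?O" for n
    by (simp_all add: Q_def Q'_def)
  have space_Q [simp]: "space (Q n) = orthant N" "space Q' = orthant N" for n
    by (simp_all add: Q_def Q'_def space_orthant_algebra)
  have upto: "martingale_upto N (Q n) ?F ?X" for n
    using mart[of n] unfolding martingale_measure_def Q_def[symmetric] by auto
  \<comment> \<open>Being a subalgebra depends only on the space and the measurable sets, which
    \<open>Q'\<close> shares with \<open>Q 0\<close>.\<close>
  have subF: "subalgebra Q' (?F i)" if "i \<le> N" for i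
    using upto[of 0] that unfolding martingale_upto_def subalgebra_def by auto
  have intX_n: "integrable M (\<lambda>x. ?X i (Z n x))" if "i \<le> N" for i n
  proof -
    have "integrable (Q n) (?X i)" using upto[of n] that unfolding martingale_upto_def by auto
    then show ?thesis unfolding Q_def using that by (subst (asm) integrable_distr_eq) auto
  qed
  have intX: "integrable M (\<lambda>x. ?X i (Z' x))" if "i \<le> N" for i
    using int[of i] that by (cases "i = 0") auto
  have limX: "AE x in M. (\<lambda>n. ?X i (Z n x)) \<longlonglongrightarrow> ?X i (Z' x)" if "i \<le> N" for i
    using lim[of i] that by (cases "i = 0") auto
  have lim_intX: "(\<lambda>n. \<integral>x. ?X i (Z n x) \<partial>M) \<longlonglongrightarrow> (\<integral>x. ?X i (Z' x) \<partial>M)" if "i \<le> N" for i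
    using lim_int[of i] that by (cases "i = 0") auto
  have X_nonneg: "0 \<le> ?X i (Z n x)" if "i \<le> N" "x \<in> space M" for i n x
  proof (cases "i = 0")
    case False
    then show ?thesis using measurable_space[OF Z that(2), of n] that(1)
      by (auto simp: space_orthant_algebra)
  qed (use \<open>0 \<le> x0\<close> in simp)
  have meas_X [measurable]: "(\<lambda>x. ?X i (Z n x)) \<in> borel_measurable M" "(\<lambda>x. ?X i (Z' x)) \<in> borel_measurable M"
    if "i \<le> N" for i n
    using measurable_compose[OF Z measurable_canonical_process[OF that]]
      measurable_compose[OF Z' measurable_canonical_process[OF that]] by auto
  have test: "(\<integral>x. (\<Prod>k\<le>i. g k (?X k (Z' x))) * ?X j (Z' x) \<partial>M) = (\<integral>x. (\<Prod>k\<le>i. g k (?X k (Z' x))) * ?X i (Z' x) \<partial>M)"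
    if ij: "i \<le> j" "j \<le> N" and g: "\<And>k. continuous_on UNIV (g k)" "\<And>k x. 0 \<le> g k x" "\<And>k x. g k x \<le> 1"
    for i j and g :: "nat \<Rightarrow> real \<Rightarrow> real"
  proof -
    have [measurable]: "g k \<in> borel_measurable borel" for k
      by (rule borel_measurable_continuous_onI[OF g(1)])
    let ?f = "\<lambda>\<omega>. \<Prod>k\<le>i. g k (?X k \<omega>)"
    have f1: "0 \<le> ?f \<omega>" "?f \<omega> \<le> 1" for \<omega> using g by (auto intro: prod_nonneg prod_le_1)
    have f_meas: "?f \<in> borel_measurable (?F i)"
      by (intro borel_measurable_prod measurable_compose[OF measurable_natural_filtration]) auto
    have f_meas_O: "?f \<in> borel_measurable ?O"
      using measurable_from_subalg[OF subF f_meas] ij by (simp cong: measurable_cong_sets)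
    have fZ [measurable]: "(\<lambda>x. ?f (Z n x)) \<in> borel_measurable M" "(\<lambda>x. ?f (Z' x)) \<in> borel_measurable M" for n
      using measurable_compose[OF Z f_meas_O] measurable_compose[OF Z' f_meas_O] by auto
    have conv: "(\<lambda>n. \<integral>x. ?f (Z n x) * ?X l (Z n x) \<partial>M) \<longlonglongrightarrow> (\<integral>x. ?f (Z' x) * ?X l (Z' x) \<partial>M)"
      if l: "l \<le> N" for l
    proof (rule generalized_dominated_convergence[where g = "\<lambda>n x. ?X l (Z n x)" and g' = "\<lambda>x. ?X l (Z' x)"])
      have "AE x in M. \<forall>k\<in>{..N}. (\<lambda>n. ?X k (Z n x)) \<longlonglongrightarrow> ?X k (Z' x)"
        by (rule AE_finite_allI) (auto intro: limX)
      then show "AE x in M. (\<lambda>n. ?f (Z n x) * ?X l (Z n x)) \<longlonglongrightarrow> ?f (Z' x) * ?X l (Z' x)"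
      proof eventually_elim
        case (elim x)
        have "(\<lambda>n. g k (?X k (Z n x))) \<longlonglongrightarrow> g k (?X k (Z' x))" if "k \<le> i" for k
          using elim that ij g(1)[of k]
          by (intro isCont_tendsto_compose[where g = "g k"]) (auto simp: continuous_on_eq_continuous_at)
        then show ?case using elim l by (intro tendsto_mult tendsto_prod) auto
      qed
      show "AE x in M. \<bar>?f (Z n x) * ?X l (Z n x)\<bar> \<le> ?X l (Z n x)" for n
      proof (rule AE_I2)
        fix x assume x: "x \<in> space M"
        show "\<bar>?f (Z n x) * ?X l (Z n x)\<bar> \<le> ?X l (Z n x)"
          using f1[of "Z n x"] X_nonneg[OF l x, of n] by (simp add: abs_mult mult_left_le_one_le)
      qed
    qed (use l in \<open>auto intro: intX_n intX limX lim_intX\<close>)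
    have "(\<integral>x. ?f (Z n x) * ?X j (Z n x) \<partial>M) = (\<integral>x. ?f (Z n x) * ?X i (Z n x) \<partial>M)" for n
    proof -
      have tr: "(\<integral>x. ?f (Z n x) * ?X l (Z n x) \<partial>M) = (\<integral>\<omega>. ?f \<omega> * ?X l \<omega> \<partial>Q n)" if l: "l \<le> N" for l
      proof -
        have "(\<lambda>\<omega>. ?f \<omega> * ?X l \<omega>) \<in> borel_measurable ?O"
          by (intro borel_measurable_times f_meas_O measurable_canonical_process l)
        then show ?thesis unfolding Q_def by (simp add: integral_distr[OF Z])
      qed
      have "(\<integral>\<omega>. ?f \<omega> * ?X j \<omega> \<partial>Q n) = (\<integral>\<omega>. ?f \<omega> * ?X i \<omega> \<partial>Q n)"
        by (rule Q.martingale_upto_test[OF upto ij f_meas, of 1]) (use f1 in auto)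
      then show ?thesis using tr ij by simp
    qed
    then show ?thesis
      using LIMSEQ_unique[OF conv[of j]] conv[of i] ij by simp
  qed
  txt \<open>Continuous ramps decreasing to the indicators of \<open>{..a k}\<close>.\<close>
  have boxes: "(\<integral>x. (\<Prod>k\<le>i. indicator {..a k} (?X k (Z' x))) * ?X j (Z' x) \<partial>M)
      = (\<integral>x. (\<Prod>k\<le>i. indicator {..a k} (?X k (Z' x))) * ?X i (Z' x) \<partial>M)"
    if ij: "i \<le> j" "j \<le> N" for i j and a :: "nat \<Rightarrow> real"
  proof -
    define g where "g m k x = max 0 (min 1 (1 - real m * (x - a k)))" for m k x
    have g01: "0 \<le> g m k x" "g m k x \<le> 1" for m k x unfolding g_def by auto
    have g_cont: "continuous_on UNIV (g m k)" for m k unfolding g_def by (intro continuous_intros)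
    have [measurable]: "g m k \<in> borel_measurable borel" for m k
      by (rule borel_measurable_continuous_onI[OF g_cont])
    have g_lim: "(\<lambda>m. g m k x) \<longlonglongrightarrow> indicator {..a k} x" for k x
    proof (cases "x \<le> a k")
      case True
      then have "real m * (x - a k) \<le> 0" for m by (simp add: mult_nonneg_nonpos)
      then have "g m k x = 1" for m unfolding g_def by (smt (verit))
      then show ?thesis using True by simp
    next
      case False
      then obtain n0 :: nat where n0: "1 \<le> real n0 * (x - a k)"
        using reals_Archimedean3[of "x - a k"] by (metis diff_gt_0_iff_gt less_imp_le not_le)
      have "g m k x = 0" if "n0 \<le> m" for m
      proof -
        have "real n0 * (x - a k) \<le> real m * (x - a k)" using that False by (intro mult_right_mono) auto
        then show ?thesis using n0 unfolding g_def by simp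
      qed
      then show ?thesis using False by (intro tendsto_eventually eventually_sequentiallyI[of n0]) simp
    qed
    have conv: "(\<lambda>m. \<integral>x. (\<Prod>k\<le>i. g m k (?X k (Z' x))) * ?X l (Z' x) \<partial>M)
        \<longlonglongrightarrow> (\<integral>x. (\<Prod>k\<le>i. indicator {..a k} (?X k (Z' x))) * ?X l (Z' x) \<partial>M)" if l: "l \<le> N" for l
    proof (rule integral_dominated_convergence[where w = "\<lambda>x. \<bar>?X l (Z' x)\<bar>"])
      have [measurable]: "(\<lambda>x. ?X k (Z' x)) \<in> borel_measurable M" if "k \<in> {..i}" for k
        using that ij by (intro meas_X) auto
      note [measurable] = meas_X(2)[OF l]
      show "(\<lambda>x. (\<Prod>k\<le>i. indicator {..a k} (?X k (Z' x))) * ?X l (Z' x)) \<in> borel_measurable M"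
        by measurable
      show "(\<lambda>x. (\<Prod>k\<le>i. g m k (?X k (Z' x))) * ?X l (Z' x)) \<in> borel_measurable M" for m
        by measurable
      show "integrable M (\<lambda>x. \<bar>?X l (Z' x)\<bar>)" using intX[OF l] by simp
      show "AE x in M. (\<lambda>m. (\<Prod>k\<le>i. g m k (?X k (Z' x))) * ?X l (Z' x))
          \<longlonglongrightarrow> (\<Prod>k\<le>i. indicator {..a k} (?X k (Z' x))) * ?X l (Z' x)"
        by (intro AE_I2 tendsto_mult tendsto_prod g_lim tendsto_const)
      show "AE x in M. norm ((\<Prod>k\<le>i. g m k (?X k (Z' x))) * ?X l (Z' x)) \<le> \<bar>?X l (Z' x)\<bar>" for m
      proof (rule AE_I2)
        fix x
        have "0 \<le> (\<Prod>k\<le>i. g m k (?X k (Z' x)))" "(\<Prod>k\<le>i. g m k (?X k (Z' x))) \<le> 1"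
          using g01 by (auto intro: prod_nonneg prod_le_1)
        then show "norm ((\<Prod>k\<le>i. g m k (?X k (Z' x))) * ?X l (Z' x)) \<le> \<bar>?X l (Z' x)\<bar>"
          by (simp add: abs_mult mult_left_le_one_le)
      qed
    qed
    show ?thesis
      using LIMSEQ_unique[OF conv[of j]] conv[of i] ij
      unfolding test[OF ij g_cont g01] by simp
  qed
  have "martingale_upto N Q' (natural_filtration (space Q') ?X) ?X"
  proof (rule Q'.martingale_uptoI_boxes)
    show "subalgebra Q' (natural_filtration (space Q') ?X i)" if "i \<le> N" for i
      using subF[OF that] by simp
    show "integrable Q' (?X i)" if "i \<le> N" for i
      unfolding Q'_def using intX[OF that] that by (subst integrable_distr_eq[OF Z']) auto
    have total: "(\<integral>x. ?X i x \<partial>Q') = (\<integral>x. ?X i (Z' x) \<partial>M)" if "i \<le> N" for i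
      unfolding Q'_def by (rule integral_distr[OF Z' measurable_canonical_process[OF that]])
    fix i j :: nat and a :: "nat \<Rightarrow> real" assume ij: "i \<le> j" "j \<le> N"
    \<comment> \<open>With all factors equal to 1 the test identity is the equality of
      means.\<close>
    show "(\<integral>x. ?X j x \<partial>Q') = (\<integral>x. ?X i x \<partial>Q')"
      using test[OF ij, of "\<lambda>_ _. 1"] total ij by simp
    have box: "(LINT \<omega>:{\<omega> \<in> space Q'. \<forall>k\<le>i. ?X k \<omega> \<le> a k}|Q'. ?X l \<omega>)
        = (\<integral>x. (\<Prod>k\<le>i. indicator {..a k} (?X k (Z' x))) * ?X l (Z' x) \<partial>M)" if l: "l \<le> N" for l
    proof -
      have [measurable]: "?X k \<in> borel_measurable ?O" if "k \<in> {..i}" for k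
        using that ij by (intro measurable_canonical_process) auto
      note [measurable] = measurable_canonical_process[OF l]
      have prod_ind: "(\<Prod>k\<le>i. indicator {..a k} (?X k \<omega>)) = (if \<forall>k\<le>i. ?X k \<omega> \<le> a k then 1 else 0 :: real)" for \<omega>
        by (auto simp: indicator_def prod_zero_iff intro!: prod.neutral)
      have "(LINT \<omega>:{\<omega> \<in> space Q'. \<forall>k\<le>i. ?X k \<omega> \<le> a k}|Q'. ?X l \<omega>)
          = (\<integral>\<omega>. (\<Prod>k\<le>i. indicator {..a k} (?X k \<omega>)) * ?X l \<omega> \<partial>Q')"
        unfolding set_lebesgue_integral_def prod_ind
        by (rule Bochner_Integration.integral_cong) (auto simp: indicator_def)
      also have "\<dots> = (\<integral>x. (\<Prod>k\<le>i. indicator {..a k} (?X k (Z' x))) * ?X l (Z' x) \<partial>M)"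
        unfolding Q'_def by (rule integral_distr[OF Z']) measurable
      finally show ?thesis .
    qed
    show "(LINT \<omega>:{\<omega> \<in> space Q'. \<forall>k\<le>i. ?X k \<omega> \<le> a k}|Q'. ?X j \<omega>)
        = (LINT \<omega>:{\<omega> \<in> space Q'. \<forall>k\<le>i. ?X k \<omega> \<le> a k}|Q'. ?X i \<omega>)"
      using box[of j] box[of i] boxes[OF ij, of a] ij by simp
  qed
  then show ?thesis unfolding martingale_measure_def Q'_def[symmetric] using Q' by simp
qed

section \<open>Upper semicontinuous payoffs and the limit theorem\<close>

lemma topspace_orthant_topology: "topspace (orthant_topology N) = orthant N"
  by (simp add: orthant_topology_def)

text \<open>The orthant consists of extensional functions, whereas Borel sets come from the topology
  of the full function type. Restriction to \<open>{1..N}\<close> is continuous, and pulling back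
  along it gives an open set with the required trace.\<close>

lemma openin_orthant_topologyE:
  assumes "openin (orthant_topology N) U"
  obtains V where "open V" "U = V \<inter> orthant N"
proof -
  let ?T = "product_topology (\<lambda>i. euclidean :: real topology) {1..N}"
  have "orthant_topology N = subtopology ?T (orthant N)"
    unfolding orthant_topology_def by (rule subtopology_product_topology[symmetric])
  then obtain W where W: "openin ?T W" "U = W \<inter> orthant N"
    using assms by (auto simp: openin_subtopology)
  have "continuous_map euclidean ?T (\<lambda>x. restrict x {1..N})"
    unfolding continuous_map_componentwise
    by (auto intro: continuous_on_product_coordinates)
  from openin_continuous_map_preimage[OF this W(1)]
  have "open {x. restrict x {1..N} \<in> W}" by simp
  moreover have "U = {x. restrict x {1..N} \<in> W} \<inter> orthant N"
    unfolding W(2) by (auto simp: PiE_restrict)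
  ultimately show thesis by (rule that)
qed

lemma upper_semicontinuous_measurable:
  assumes "upper_semicontinuous_map (orthant_topology N) h"
  shows "h \<in> borel_measurable (orthant_algebra N)"
  unfolding borel_measurable_iff_less
proof
  fix c
  have "openin (orthant_topology N) {x \<in> orthant N. h x < c}"
    using assms unfolding upper_semicontinuous_map_def topspace_orthant_topology by blast
  then obtain V where V: "open V" "{x \<in> orthant N. h x < c} = V \<inter> orthant N"
    by (rule openin_orthant_topologyE)
  have "(\<lambda>\<omega>. \<omega>) \<in> borel_measurable (orthant_algebra N)"
  proof (rule measurable_coordinatewise_then_product)
    fix i
    show "(\<lambda>\<omega>. \<omega> i) \<in> borel_measurable (orthant_algebra N)"
    proof (cases "i \<in> {1..N}")
      \<comment> \<open>Outside \<open>{1..N}\<close> an extensional function has the fixed value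
        \<open>undefined\<close>, so the coordinate is constant.\<close>
      case False
      then have "\<omega> i = undefined" if "\<omega> \<in> space (orthant_algebra N)" for \<omega>
        using that by (auto simp: space_orthant_algebra PiE_def extensional_def)
      then show ?thesis by (subst measurable_cong[where g = "\<lambda>_. undefined"]) auto
    qed (rule measurable_orthant_component)
  qed
  from measurable_sets[OF this borel_open[OF V(1)]]
  show "{\<omega> \<in> space (orthant_algebra N). h \<omega> < c} \<in> sets (orthant_algebra N)"
    by (simp only: space_orthant_algebra V(2) vimage_ident)
qed

text \<open>Convergence in a product topology is coordinatewise, so the sequence eventually enters
  the open sublevel set around its limit.\<close>

lemma upper_semicontinuous_eventually_less:
  assumes h: "upper_semicontinuous_map (orthant_topology N) h"
    and z: "\<And>n. z n \<in> orthant N" "z' \<in> orthant N" "\<And>i. i \<in> {1..N} \<Longrightarrow> (\<lambda>n. z n i) \<longlonglongrightarrow> z' i"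
    and c: "h z' < c"
  shows "\<forall>\<^sub>F n in sequentially. h (z n) < c"
proof -
  have "limitin (orthant_topology N) z z' sequentially"
    unfolding orthant_topology_def limitin_componentwise
  proof (intro conjI ballI)
    show "z' \<in> extensional {1..N}" using z(2) by (simp add: PiE_def)
    show "\<forall>\<^sub>F n in sequentially. z n \<in> topspace (product_topology (\<lambda>i. top_of_set {0..}) {1..N})"
      using z(1) by simp
    fix i assume i: "i \<in> {1..N}"
    then show "limitin (top_of_set {0..}) (\<lambda>n. z n i) (z' i) sequentially"
      using z by (auto simp: limitin_subtopology PiE_def Pi_def intro!: always_eventually)
  qed
  moreover have "openin (orthant_topology N) {x \<in> orthant N. h x < c}"
    using h unfolding upper_semicontinuous_map_def topspace_orthant_topology by blast
  ultimately have "\<forall>\<^sub>F n in sequentially. z n \<in> {x \<in> orthant N. h x < c}"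
    using z(2) c unfolding limitin_def by blast
  then show ?thesis by eventually_elim simp
qed

text \<open>On the orthant the Euclidean norm is at most the sum of the coordinates, which is
  integrable. This makes the expectation of \<open>h\<close> a genuine one; a nonintegrable function
  would have integral 0 by convention.\<close>

lemma integrable_linear_growth:
  assumes h: "h \<in> borel_measurable (orthant_algebra N)"
    and growth: "linear_growth_on (\<lambda>x. L2_set x {1..N}) (orthant N) h"
    and M: "prob_space M" and Z: "Z \<in> M \<rightarrow>\<^sub>M orthant_algebra N"
    and int: "\<And>i. i \<in> {1..N} \<Longrightarrow> integrable M (\<lambda>x. Z x i)"
  shows "integrable M (\<lambda>x. h (Z x))"
proof -
  interpret prob_space M by (rule M)
  obtain C where C: "\<And>\<omega>. \<omega> \<in> orthant N \<Longrightarrow> \<bar>h \<omega>\<bar> / (1 + L2_set \<omega> {1..N}) \<le> C"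
    using growth unfolding linear_growth_on_def bdd_above_def by auto
  have bound: "\<bar>h \<omega>\<bar> \<le> \<bar>C\<bar> * (1 + (\<Sum>i=1..N. \<omega> i))" if \<omega>: "\<omega> \<in> orthant N" for \<omega>
  proof -
    have "\<bar>h \<omega>\<bar> \<le> C * (1 + L2_set \<omega> {1..N})"
      using C[OF \<omega>] L2_set_nonneg[of \<omega> "{1..N}"]
      by (subst (asm) pos_divide_le_eq) (simp_all add: add_pos_nonneg del: One_nat_def)
    also have "\<dots> \<le> \<bar>C\<bar> * (1 + L2_set \<omega> {1..N})"
      using L2_set_nonneg[of \<omega> "{1..N}"] by (intro mult_right_mono) auto
    also have "\<dots> \<le> \<bar>C\<bar> * (1 + (\<Sum>i=1..N. \<omega> i))"
      using \<omega> by (intro mult_left_mono add_left_mono L2_set_le_sum) auto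
    finally show ?thesis .
  qed
  show ?thesis
  proof (rule Bochner_Integration.integrable_bound)
    show "integrable M (\<lambda>x. \<bar>C\<bar> * (1 + (\<Sum>i=1..N. Z x i)))"
      using int by (intro integrable_mult_right Bochner_Integration.integrable_add Bochner_Integration.integrable_sum) auto
    show "(\<lambda>x. h (Z x)) \<in> borel_measurable M" by (rule measurable_compose[OF Z h])
    show "AE x in M. norm (h (Z x)) \<le> norm (\<bar>C\<bar> * (1 + (\<Sum>i=1..N. Z x i)))"
    proof (rule AE_I2)
      fix x assume "x \<in> space M"
      then have "Z x \<in> orthant N" using measurable_space[OF Z] by (simp add: space_orthant_algebra)
      from bound[OF this] show "norm (h (Z x)) \<le> norm (\<bar>C\<bar> * (1 + (\<Sum>i=1..N. Z x i)))"
        by simp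
    qed
  qed
qed

text \<open>The values of \<open>h\<close> along the sequence need not converge, so Fatou's lemma is
  applied to \<open>B - h\<close> in its \<open>liminf\<close> form, with semicontinuity providing
  the pointwise inequality.\<close>

lemma upper_semicontinuous_expectation_limit:
  assumes usc: "upper_semicontinuous_map (orthant_topology N) h"
    and growth: "linear_growth_on (\<lambda>x. L2_set x {1..N}) (orthant N) h"
    and bdd: "bdd_above (h ` orthant N)"
    and M: "prob_space M" and Z: "\<And>n. Z n \<in> M \<rightarrow>\<^sub>M orthant_algebra N" and Z': "Z' \<in> M \<rightarrow>\<^sub>M orthant_algebra N"
    and int: "\<And>n i. i \<in> {1..N} \<Longrightarrow> integrable M (\<lambda>x. Z n x i)"
    and int': "\<And>i. i \<in> {1..N} \<Longrightarrow> integrable M (\<lambda>x. Z' x i)"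
    and lim: "\<And>i. i \<in> {1..N} \<Longrightarrow> AE x in M. (\<lambda>n. Z n x i) \<longlonglongrightarrow> Z' x i"
    and c: "\<And>n. c \<le> (\<integral>x. h (Z n x) \<partial>M)"
  shows "c \<le> (\<integral>x. h (Z' x) \<partial>M)"
proof -
  interpret prob_space M by (rule M)
  note h = upper_semicontinuous_measurable[OF usc]
  note ih = integrable_linear_growth[OF h growth M Z int]
  note ih' = integrable_linear_growth[OF h growth M Z' int']
  have [measurable]: "(\<lambda>x. h (Z n x)) \<in> borel_measurable M" for n by (rule measurable_compose[OF Z h])
  obtain B where B: "\<And>\<omega>. \<omega> \<in> orthant N \<Longrightarrow> h \<omega> \<le> B" using bdd unfolding bdd_above_def by auto
  have orth: "Z n x \<in> orthant N" "Z' x \<in> orthant N" if "x \<in> space M" for n x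
    using measurable_space[OF Z that] measurable_space[OF Z' that] by (auto simp: space_orthant_algebra)
  have pos: "AE x in M. 0 \<le> B - h (Z n x)" "AE x in M. 0 \<le> B - h (Z' x)" for n
    using B orth by (auto intro!: AE_I2)
  have int_B: "(\<integral>x. B - h (Z n x) \<partial>M) = B - (\<integral>x. h (Z n x) \<partial>M)"
    "(\<integral>x. B - h (Z' x) \<partial>M) = B - (\<integral>x. h (Z' x) \<partial>M)" for n
    using ih ih' by (simp_all add: prob_space)
  have "AE x in M. \<forall>i\<in>{1..N}. (\<lambda>n. Z n x i) \<longlonglongrightarrow> Z' x i"
    by (rule AE_finite_allI) (auto intro: lim)
  then have "AE x in M. ennreal (B - h (Z' x)) \<le> liminf (\<lambda>n. ennreal (B - h (Z n x)))"
    using AE_space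
  proof eventually_elim
    case (elim x)
    show ?case
      unfolding le_Liminf_iff
    proof (intro allI impI)
      \<comment> \<open>A value below a finite \<open>ennreal\<close> is a nonnegative real
        \<open>t\<close>, and the claim reduces to \<open>h\<close> eventually falling below the
        level \<open>B - t\<close>.\<close>
      fix y assume y: "y < ennreal (B - h (Z' x))"
      then have "y < \<top>" by (rule less_trans) simp
      then obtain t where t: "y = ennreal t" "0 \<le> t" by (cases y) auto
      have "t < B - h (Z' x)" using y t by (simp add: ennreal_less_iff)
      then have "h (Z' x) < B - t" by simp
      then have "\<forall>\<^sub>F n in sequentially. h (Z n x) < B - t"
        using elim orth by (intro upper_semicontinuous_eventually_less[OF usc, of "\<lambda>n. Z n x" "Z' x"]) auto
      then show "\<forall>\<^sub>F n in sequentially. y < ennreal (B - h (Z n x))"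
        by eventually_elim (use t in \<open>simp add: ennreal_less_iff\<close>)
    qed
  qed
  then have "(\<integral>\<^sup>+x. ennreal (B - h (Z' x)) \<partial>M) \<le> (\<integral>\<^sup>+x. liminf (\<lambda>n. ennreal (B - h (Z n x))) \<partial>M)"
    by (rule nn_integral_mono_AE)
  also have "\<dots> \<le> liminf (\<lambda>n. \<integral>\<^sup>+x. ennreal (B - h (Z n x)) \<partial>M)"
    by (rule nn_integral_liminf) measurable
  also have "\<dots> \<le> liminf (\<lambda>n. ennreal (B - c))"
  proof (intro Liminf_mono always_eventually allI)
    fix n
    have "(\<integral>\<^sup>+x. ennreal (B - h (Z n x)) \<partial>M) = ennreal (\<integral>x. B - h (Z n x) \<partial>M)"
      by (rule nn_integral_eq_integral) (use ih pos in auto)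
    also have "\<dots> \<le> ennreal (B - c)" unfolding int_B using c[of n] by (intro ennreal_leI) simp
    finally show "(\<integral>\<^sup>+x. ennreal (B - h (Z n x)) \<partial>M) \<le> ennreal (B - c)" .
  qed
  also have "\<dots> = ennreal (B - c)" by (simp add: Liminf_const)
  finally have le: "(\<integral>\<^sup>+x. ennreal (B - h (Z' x)) \<partial>M) \<le> ennreal (B - c)" .
  have "0 \<le> (\<integral>x. B - h (Z 0 x) \<partial>M)" by (rule integral_nonneg_AE[OF pos(1)])
  then have "0 \<le> B - c" using c[of 0] unfolding int_B by linarith
  have "(\<integral>\<^sup>+x. ennreal (B - h (Z' x)) \<partial>M) = ennreal (\<integral>x. B - h (Z' x) \<partial>M)"
    by (rule nn_integral_eq_integral) (use ih' pos in auto)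
  with le \<open>0 \<le> B - c\<close> have "(\<integral>x. B - h (Z' x) \<partial>M) \<le> B - c" by simp
  then show ?thesis unfolding int_B by linarith
qed

section \<open>The sets of bid-ask martingale measures and their limit\<close>

lemma martingale_measure_component:
  assumes Q: "martingale_measure N x0 Q" and i: "i \<in> {1..N}"
  shows "integrable Q (\<lambda>\<omega>. \<omega> i)" "(\<integral>\<omega>. \<omega> i \<partial>Q) = x0"
proof -
  interpret prob_space Q using Q by (simp add: martingale_measure_def)
  have upto: "martingale_upto N Q (natural_filtration (orthant N) (canonical_process x0)) (canonical_process x0)"
    using Q by (simp add: martingale_measure_def)
  have X: "canonical_process x0 i = (\<lambda>\<omega>. \<omega> i)" using i by (auto simp: canonical_process_def)
  show "integrable Q (\<lambda>\<omega>. \<omega> i)" using upto i X unfolding martingale_upto_def by fastforce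
  \<comment> \<open>The constant test function 1 compares time \<open>i\<close> with time 0, where
    the process is \<open>x0\<close>.\<close>
  show "(\<integral>\<omega>. \<omega> i \<partial>Q) = x0"
    using martingale_upto_test[OF upto, of 0 i "\<lambda>_. 1" 1] i X by (simp add: prob_space)
qed

lemma half_line_distribution_law:
  assumes Q: "martingale_measure N x0 Q" and i: "i \<in> {1..N}"
  shows "half_line_distribution (law Q i)"
proof -
  interpret prob_space Q using Q by (simp add: martingale_measure_def)
  have "space Q = orthant N"
    using Q sets_eq_imp_space_eq[of Q "orthant_algebra N"]
    by (simp add: martingale_measure_def space_orthant_algebra)
  then have "AE \<omega> in Q. 0 \<le> \<omega> i" using i by (intro AE_I2) auto
  then show ?thesis
    unfolding law_def by (rule half_line_distribution_distr[OF martingale_measure_component(1)[OF Q i]])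
qed

lemma bid_ask_martingale_measures_mono:
  assumes "\<And>i. i \<in> {1..N} \<Longrightarrow> cx_le (\<mu>b' i) (\<mu>b i)" "\<And>i. i \<in> {1..N} \<Longrightarrow> cx_le (\<mu>a i) (\<mu>a' i)"
  shows "bid_ask_martingale_measures N x0 \<mu>b \<mu>a \<subseteq> bid_ask_martingale_measures N x0 \<mu>b' \<mu>a'"
  unfolding bid_ask_martingale_measures_def using cx_le_trans assms by blast

lemma bid_ask_martingale_measures_eq:
  assumes \<mu>: "\<And>i. i \<in> {1..N} \<Longrightarrow> half_line_distribution (\<mu> i)" and eq: "\<And>i. i \<in> {1..N} \<Longrightarrow> \<mu>' i = \<mu> i"
  shows "bid_ask_martingale_measures N x0 \<mu> \<mu>' = martingale_measures_with_marginals N x0 \<mu>"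
proof -
  have "law Q i = \<mu> i \<longleftrightarrow> cx_le (\<mu> i) (law Q i) \<and> cx_le (law Q i) (\<mu>' i)"
    if "martingale_measure N x0 Q" "i \<in> {1..N}" for Q i
    using cx_le_antisym[OF half_line_distribution_law[OF that] \<mu>[OF that(2)]] eq[OF that(2)]
    by (auto simp: cx_le_refl)
  then show ?thesis
    unfolding bid_ask_martingale_measures_def martingale_measures_with_marginals_def by blast
qed

text \<open>One limit measure serves every payoff: \<open>Q'\<close> is fixed before
  \<open>h\<close> and \<open>c\<close>. Both marginal constraints pass to it because the laws along
  the subsequence and the bid and ask marginals all converge in the sense of
  \<open>cx_tendsto\<close>, under which the order is closed.\<close>

lemma bid_ask_martingale_measures_limit:
  assumes "0 \<le> x0" and Q: "\<And>n. Q n \<in> bid_ask_martingale_measures N x0 (\<mu>b n) (\<mu>a n)"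
    and lim_b: "\<And>i. i \<in> {1..N} \<Longrightarrow> cx_tendsto (\<lambda>n. \<mu>b n i) (\<mu>b' i)"
    and lim_a: "\<And>i. i \<in> {1..N} \<Longrightarrow> cx_tendsto (\<lambda>n. \<mu>a n i) (\<mu>a' i)"
    and dom: "\<And>n i. i \<in> {1..N} \<Longrightarrow> cx_le (\<mu>a n i) (\<nu> i)"
    and \<nu>: "\<And>i. i \<in> {1..N} \<Longrightarrow> half_line_distribution (\<nu> i)"
  obtains Q' where "Q' \<in> bid_ask_martingale_measures N x0 \<mu>b' \<mu>a'"
    "\<And>h c. upper_semicontinuous_map (orthant_topology N) h \<Longrightarrow>
       linear_growth_on (\<lambda>x. L2_set x {1..N}) (orthant N) h \<Longrightarrow> bdd_above (h ` orthant N) \<Longrightarrow>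
       (\<And>n. c \<le> (\<integral>\<omega>. h \<omega> \<partial>Q n)) \<Longrightarrow> c \<le> (\<integral>\<omega>. h \<omega> \<partial>Q')"
proof -
  have mart: "martingale_measure N x0 (Q n)" for n
    using Q[of n] by (simp add: bid_ask_martingale_measures_def)
  have prob: "prob_space (Q n)" and sets_Q: "sets (Q n) = sets (orthant_algebra N)" for n
    using mart[of n] by (simp_all add: martingale_measure_def)
  \<comment> \<open>The martingale property fixes every coordinate mean at \<open>x0\<close>, the
    uniform bound that prevents escape of mass.\<close>
  obtain r and M :: "real measure" and Z Z' where r: "strict_mono r" and M: "prob_space M"
    and Z: "\<And>n. Z n \<in> M \<rightarrow>\<^sub>M orthant_algebra N" and Z': "Z' \<in> M \<rightarrow>\<^sub>M orthant_algebra N"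
    and distr_Z: "\<And>n. distr M (orthant_algebra N) (Z n) = Q (r n)"
    and lim: "\<And>i. i \<in> {1..N} \<Longrightarrow> AE x in M. (\<lambda>n. Z n x i) \<longlonglongrightarrow> Z' x i"
    by (rule orthant_as_convergent_subsequence[of Q, OF prob sets_Q
          martingale_measure_component(1)[OF mart] eq_refl[OF martingale_measure_component(2)[OF mart]]])
       (assumption | rule that)+
  interpret prob_space M by (rule M)
  define Q' where "Q' = distr M (orthant_algebra N) Z'"
  have comp: "(\<lambda>x. Z n x i) \<in> borel_measurable M" "(\<lambda>x. Z' x i) \<in> borel_measurable M" if "i \<in> {1..N}" for n i
    using measurable_compose[OF Z measurable_orthant_component[OF that]]
      measurable_compose[OF Z' measurable_orthant_component[OF that]] by auto
  have law_Z: "law (Q (r n)) i = distr M borel (\<lambda>x. Z n x i)" "law Q' i = distr M borel (\<lambda>x. Z' x i)"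
    if "i \<in> {1..N}" for n i
    unfolding law_def distr_Z[symmetric] Q'_def
    using distr_distr[OF measurable_orthant_component[OF that] Z]
      distr_distr[OF measurable_orthant_component[OF that] Z'] by (simp_all add: o_def)
  have int: "integrable M (\<lambda>x. Z n x i)" if "i \<in> {1..N}" for n i
    using martingale_measure_component(1)[OF mart that, of "r n"]
      integrable_distr_eq[OF Z measurable_orthant_component[OF that], of n] by (simp add: distr_Z)
  have nonneg: "AE x in M. 0 \<le> Z n x i" if "i \<in> {1..N}" for n i
  proof (rule AE_I2)
    fix x assume "x \<in> space M"
    from measurable_space[OF Z this, of n] have "Z n x \<in> orthant N" by (simp only: space_orthant_algebra)
    from PiE_mem[OF this that] show "0 \<le> Z n x i" by simp
  qed
  have le_law: "cx_le (\<mu>b n i) (law (Q n) i)" "cx_le (law (Q n) i) (\<mu>a n i)" if "i \<in> {1..N}" for n i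
    using Q[of n] that by (auto simp: bid_ask_martingale_measures_def)
  have lims: "integrable M (\<lambda>x. Z' x i)" "(\<lambda>n. \<integral>x. Z n x i \<partial>M) \<longlonglongrightarrow> (\<integral>x. Z' x i \<partial>M)"
    "cx_tendsto (\<lambda>n. law (Q (r n)) i) (law Q' i)" if i: "i \<in> {1..N}" for i
  proof -
    have "cx_le (distr M borel (\<lambda>x. Z n x i)) (\<nu> i)" for n
      using cx_le_trans[OF le_law(2)[OF i] dom[OF i]] by (simp add: law_Z(1)[OF i, symmetric])
    note L = cx_dominated_limit[OF int[OF i] comp(2)[OF i] nonneg[OF i] lim[OF i] this \<nu>[OF i]]
    show "integrable M (\<lambda>x. Z' x i)" "(\<lambda>n. \<integral>x. Z n x i \<partial>M) \<longlonglongrightarrow> (\<integral>x. Z' x i \<partial>M)"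
      by (rule L(1), rule L(3))
    show "cx_tendsto (\<lambda>n. law (Q (r n)) i) (law Q' i)" using L(4) by (simp add: law_Z[OF i])
  qed
  show thesis
  proof (rule that[of Q'])
    have "martingale_measure N x0 Q'"
      unfolding Q'_def
      by (rule martingale_measure_limit[OF M \<open>0 \<le> x0\<close> Z Z' _ lim lims(1,2)]) (simp_all add: distr_Z mart)
    moreover have "cx_le (\<mu>b' i) (law Q' i)" "cx_le (law Q' i) (\<mu>a' i)" if i: "i \<in> {1..N}" for i
      using cx_tendsto_le[OF cx_tendsto_subseq[OF lim_b[OF i] r] lims(3)[OF i]]
        cx_tendsto_le[OF lims(3)[OF i] cx_tendsto_subseq[OF lim_a[OF i] r]] le_law[OF i] by blast+
    ultimately show "Q' \<in> bid_ask_martingale_measures N x0 \<mu>b' \<mu>a'"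
      by (simp add: bid_ask_martingale_measures_def)
    fix h :: "(nat \<Rightarrow> real) \<Rightarrow> real" and c
    assume h: "upper_semicontinuous_map (orthant_topology N) h"
      "linear_growth_on (\<lambda>x. L2_set x {1..N}) (orthant N) h" "bdd_above (h ` orthant N)"
      and c: "\<And>n. c \<le> (\<integral>\<omega>. h \<omega> \<partial>Q n)"
    note hm = upper_semicontinuous_measurable[OF h(1)]
    have "c \<le> (\<integral>x. h (Z n x) \<partial>M)" for n
      using c[of "r n"] integral_distr[OF Z hm, of n] by (simp add: distr_Z)
    from upper_semicontinuous_expectation_limit[OF h M Z Z' int lims(1) lim this]
    show "c \<le> (\<integral>\<omega>. h \<omega> \<partial>Q')" unfolding Q'_def by (simp add: integral_distr[OF Z' hm])
  qed
qed

theorem proposition4p1: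
  fixes N :: nat and x0 :: real
    and \<mu>b \<mu>a :: "nat \<Rightarrow> nat \<Rightarrow> real measure"
  assumes "N \<ge> 1" and "x0 \<ge> 0"
    and "\<And>n. valid_marginals N x0 (\<mu>b n) (\<mu>a n)"
    and "\<And>n m i. n \<le> m \<Longrightarrow> i \<in> {1..N} \<Longrightarrow>
           cx_le (\<mu>b n i) (\<mu>b m i) \<and> cx_le (\<mu>b m i) (\<mu>a m i) \<and> cx_le (\<mu>a m i) (\<mu>a n i)"
  shows "\<exists>\<mu>b_lim \<mu>a_lim :: nat \<Rightarrow> real measure.
    (\<forall>i\<in>{1..N}. weak_conv_m (\<lambda>m. \<mu>b m i) (\<mu>b_lim i) \<and> weak_conv_m (\<lambda>m. \<mu>a m i) (\<mu>a_lim i)) \<and>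
    valid_marginals N x0 \<mu>b_lim \<mu>a_lim \<and>
    (\<forall>h :: (nat \<Rightarrow> real) \<Rightarrow> real.
       upper_semicontinuous_map (orthant_topology N) h \<longrightarrow>
       linear_growth_on (\<lambda>x. L2_set x {1..N}) (orthant N) h \<longrightarrow>
       bdd_above (h ` orthant N) \<longrightarrow>
       (\<lambda>n. sup_expectation (bid_ask_martingale_measures N x0 (\<mu>b n) (\<mu>a n)) h)
         \<longlonglongrightarrow> sup_expectation (bid_ask_martingale_measures N x0 \<mu>b_lim \<mu>a_lim) h \<and>
       ((\<forall>i\<in>{1..N}. \<mu>b_lim i = \<mu>a_lim i) \<longrightarrow>
         (\<lambda>n. sup_expectation (bid_ask_martingale_measures N x0 (\<mu>b n) (\<mu>a n)) h)
           \<longlonglongrightarrow> sup_expectation (martingale_measures_with_marginals N x0 \<mu>b_lim) h))"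
proof -
  have half_line: "half_line_distribution (\<mu>b n i)" "half_line_distribution (\<mu>a n i)"
    and mean: "(\<integral>x. x \<partial>\<mu>b n i) = x0" "(\<integral>x. x \<partial>\<mu>a n i) = x0" if "i \<in> {1..N}" for n i
    using assms(3)[of n] that by (auto simp: valid_marginals_def)
  have mono: "cx_le (\<mu>b n i) (\<mu>b m i)" "cx_le (\<mu>a m i) (\<mu>a n i)" if "n \<le> m" "i \<in> {1..N}" for n m i
    using assms(4)[OF that] by auto
  \<comment> \<open>The initial ask law dominates bids and asks alike, so one law per coordinate
    controls the tails of both families.\<close>
  have dom: "cx_le (\<mu>a n i) (\<mu>a 0 i)" "cx_le (\<mu>b n i) (\<mu>a 0 i)" if "i \<in> {1..N}" for n i
    using assms(4)[of 0 n i] that by (auto intro: cx_le_trans)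
  have "\<forall>i\<in>{1..N}. \<exists>\<mu>'. weak_conv_m (\<lambda>m. \<mu>b m i) \<mu>' \<and> half_line_distribution \<mu>' \<and>
      (\<lambda>n. \<integral>x. x \<partial>\<mu>b n i) \<longlonglongrightarrow> (\<integral>x. x \<partial>\<mu>') \<and> cx_tendsto (\<lambda>m. \<mu>b m i) \<mu>'"
  proof
    fix i assume i: "i \<in> {1..N}"
    show "\<exists>\<mu>'. weak_conv_m (\<lambda>m. \<mu>b m i) \<mu>' \<and> half_line_distribution \<mu>' \<and>
      (\<lambda>n. \<integral>x. x \<partial>\<mu>b n i) \<longlonglongrightarrow> (\<integral>x. x \<partial>\<mu>') \<and> cx_tendsto (\<lambda>m. \<mu>b m i) \<mu>'"
      by (rule cx_monotone_weak_limit_exists[OF half_line(1)[OF i] dom(2)[OF i] half_line(2)[OF i]])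
         (use mono i in blast)
  qed
  from bchoice[OF this] obtain \<mu>b_lim
    where b: "\<And>i. i \<in> {1..N} \<Longrightarrow> weak_conv_m (\<lambda>m. \<mu>b m i) (\<mu>b_lim i)"
      "\<And>i. i \<in> {1..N} \<Longrightarrow> half_line_distribution (\<mu>b_lim i)"
      "\<And>i. i \<in> {1..N} \<Longrightarrow> (\<lambda>n. \<integral>x. x \<partial>\<mu>b n i) \<longlonglongrightarrow> (\<integral>x. x \<partial>\<mu>b_lim i)"
      "\<And>i. i \<in> {1..N} \<Longrightarrow> cx_tendsto (\<lambda>m. \<mu>b m i) (\<mu>b_lim i)"
    by metis
  have "\<forall>i\<in>{1..N}. \<exists>\<mu>'. weak_conv_m (\<lambda>m. \<mu>a m i) \<mu>' \<and> half_line_distribution \<mu>' \<and>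
      (\<lambda>n. \<integral>x. x \<partial>\<mu>a n i) \<longlonglongrightarrow> (\<integral>x. x \<partial>\<mu>') \<and> cx_tendsto (\<lambda>m. \<mu>a m i) \<mu>'"
  proof
    fix i assume i: "i \<in> {1..N}"
    show "\<exists>\<mu>'. weak_conv_m (\<lambda>m. \<mu>a m i) \<mu>' \<and> half_line_distribution \<mu>' \<and>
      (\<lambda>n. \<integral>x. x \<partial>\<mu>a n i) \<longlonglongrightarrow> (\<integral>x. x \<partial>\<mu>') \<and> cx_tendsto (\<lambda>m. \<mu>a m i) \<mu>'"
      by (rule cx_monotone_weak_limit_exists[OF half_line(2)[OF i] dom(1)[OF i] half_line(2)[OF i]])
         (use mono i in blast)
  qed
  from bchoice[OF this] obtain \<mu>a_lim
    where a: "\<And>i. i \<in> {1..N} \<Longrightarrow> weak_conv_m (\<lambda>m. \<mu>a m i) (\<mu>a_lim i)"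
      "\<And>i. i \<in> {1..N} \<Longrightarrow> half_line_distribution (\<mu>a_lim i)"
      "\<And>i. i \<in> {1..N} \<Longrightarrow> (\<lambda>n. \<integral>x. x \<partial>\<mu>a n i) \<longlonglongrightarrow> (\<integral>x. x \<partial>\<mu>a_lim i)"
      "\<And>i. i \<in> {1..N} \<Longrightarrow> cx_tendsto (\<lambda>m. \<mu>a m i) (\<mu>a_lim i)"
    by metis
  have mean_lim: "(\<integral>x. x \<partial>\<mu>b_lim i) = x0" "(\<integral>x. x \<partial>\<mu>a_lim i) = x0" if i: "i \<in> {1..N}" for i
    using b(3)[OF i] a(3)[OF i] mean[OF i] by (simp_all add: LIMSEQ_const_iff)
  \<comment> \<open>The monotonicity hypothesis compares equal times only; for different times the
    order comes from validity at each \<open>n\<close> and closedness of the convex order.\<close>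
  have lim_order: "cx_le (\<mu>b_lim i) (\<mu>a_lim j)" if "i \<in> {1..N}" "j \<in> {i..N}" for i j
  proof (rule cx_tendsto_le[OF b(4) a(4)])
    show "cx_le (\<mu>b n i) (\<mu>a n j)" for n
      using assms(3)[of n] that unfolding valid_marginals_def by blast
  qed (use that in auto)
  have valid: "valid_marginals N x0 \<mu>b_lim \<mu>a_lim"
    unfolding valid_marginals_def using b(2) a(2) mean_lim lim_order by blast
  \<comment> \<open>For fixed \<open>n\<close> the constant sequence is compared with the members of
    index at least \<open>n\<close>.\<close>
  have between: "cx_le (\<mu>b n i) (\<mu>b_lim i)" "cx_le (\<mu>a_lim i) (\<mu>a n i)" if i: "i \<in> {1..N}" for n i
    using cx_tendsto_le[OF cx_tendsto_const b(4)[OF i], of n] cx_tendsto_le[OF a(4)[OF i] cx_tendsto_const, of n]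
      mono[OF _ i] by blast+
  let ?S = "\<lambda>n. bid_ask_martingale_measures N x0 (\<mu>b n) (\<mu>a n)"
  let ?S' = "bid_ask_martingale_measures N x0 \<mu>b_lim \<mu>a_lim"
  have conv: "(\<lambda>n. sup_expectation (?S n) h) \<longlonglongrightarrow> sup_expectation ?S' h"
    if h: "upper_semicontinuous_map (orthant_topology N) h"
      "linear_growth_on (\<lambda>x. L2_set x {1..N}) (orthant N) h" "bdd_above (h ` orthant N)" for h
  proof -
    have "decseq (\<lambda>n. sup_expectation (?S n) h)"
      unfolding decseq_def sup_expectation_def
      by (intro allI impI SUP_subset_mono bid_ask_martingale_measures_mono mono order_refl)
    then have "(\<lambda>n. sup_expectation (?S n) h) \<longlonglongrightarrow> (INF n. sup_expectation (?S n) h)"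
      by (rule LIMSEQ_INF)
    moreover have "sup_expectation ?S' h \<le> (INF n. sup_expectation (?S n) h)"
      unfolding sup_expectation_def
      by (intro INF_greatest SUP_subset_mono bid_ask_martingale_measures_mono between order_refl)
    moreover have "(INF n. sup_expectation (?S n) h) \<le> sup_expectation ?S' h"
    proof (rule ccontr)
      assume "\<not> ?thesis"
      then have "sup_expectation ?S' h < (INF n. sup_expectation (?S n) h)" by (simp only: not_le)
      \<comment> \<open>A real level exists even if the lower value is -\<infinity>. Every set of
        the sequence then contains a measure whose expectation exceeds it, and the limit of these
        measures keeps at least that level.\<close>
      from ereal_dense2[OF this] obtain c
        where c: "sup_expectation ?S' h < ereal c" "ereal c < (INF n. sup_expectation (?S n) h)" by blast
      have "\<exists>Q\<in>?S n. c < (\<integral>\<omega>. h \<omega> \<partial>Q)" for n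
      proof -
        have "ereal c < sup_expectation (?S n) h" by (rule less_le_trans[OF c(2) INF_lower[OF UNIV_I]])
        then show ?thesis by (auto simp: sup_expectation_def less_SUP_iff)
      qed
      then obtain Q where Q: "\<And>n. Q n \<in> ?S n" "\<And>n. c < (\<integral>\<omega>. h \<omega> \<partial>Q n)" by metis
      obtain Q' where Q': "Q' \<in> ?S'" "c \<le> (\<integral>\<omega>. h \<omega> \<partial>Q')"
      proof (rule bid_ask_martingale_measures_limit[OF \<open>x0 \<ge> 0\<close> Q(1) b(4) a(4) dom(1) half_line(2)])
        fix Q' assume Q': "Q' \<in> ?S'" and le: "\<And>h c. upper_semicontinuous_map (orthant_topology N) h \<Longrightarrow>
            linear_growth_on (\<lambda>x. L2_set x {1..N}) (orthant N) h \<Longrightarrow> bdd_above (h ` orthant N) \<Longrightarrow>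
            (\<And>n. c \<le> (\<integral>\<omega>. h \<omega> \<partial>Q n)) \<Longrightarrow> c \<le> (\<integral>\<omega>. h \<omega> \<partial>Q')"
        show thesis by (rule that[OF Q' le[OF h less_imp_le[OF Q(2)]]])
      qed
      then have "ereal c \<le> sup_expectation ?S' h"
        unfolding sup_expectation_def by (intro SUP_upper2[OF Q'(1)]) simp
      with c(1) show False by simp
    qed
    ultimately show ?thesis by (simp add: antisym)
  qed
  have "?S' = martingale_measures_with_marginals N x0 \<mu>b_lim" if "\<forall>i\<in>{1..N}. \<mu>b_lim i = \<mu>a_lim i"
    by (rule bid_ask_martingale_measures_eq) (use b(2) that in auto)
  then show ?thesis
    using b(1) a(1) valid conv by (intro exI[of _ \<mu>b_lim] exI[of _ \<mu>a_lim]) auto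
qed

end
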